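(* Fix $\kappa\in\mathbb{Z}[i]\setminus\{0\}$. Then, as $x\to\infty$, $$\sum_{\substack{\nu\in\mathbb{Z}[i],\ \nu\neq-\kappa\\ 0<N\nu\le x}}\tau(\nu)\,\tau(\nu+\kappa)=\frac{\pi^3}{16\,\zeta_K(2)}\,\sigma_{-1}(\kappa)\,x(\log x)^2+O(x\log x),$$ where $\zeta_K$ is the Dedekind zeta function of $K=\mathbb{Q}(i)$ and $\sigma_{-1}(\kappa)=\sum_{(\delta)\mid(\kappa)}N(\delta)^{-1}$, the sum being over ideals $(\delta)$ of $\mathbb{Z}[i]$ dividing $(\kappa)$.
   Context: $N\nu=|\nu|^2$ for $\nu\in\mathbb{Z}[i]$. For $\nu\in\mathbb{Z}[i]$, $\nu\ne0$, $\tau(\nu)$ is the number of ideals of $\mathbb{Z}[i]$ dividing $(\nu)$ (divisors counted up to units). The implied constant may depend on $\kappa$. *)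

theory Defs
  imports
    "HOL-Analysis.Analysis"
    "HOL-Library.Landau_Symbols"
    "HOL-Algebra.Ideal_Product"
    "HOL-Algebra.QuotRing"
begin

definition gauss_ints :: "complex set" where
  "gauss_ints = {z. Re z \<in> \<int> \<and> Im z \<in> \<int>}"

definition gauss_ring :: "complex ring" where
  "gauss_ring = \<lparr>carrier = gauss_ints, mult = (*), one = 1, zero = 0, add = (+)\<rparr>"

definition gauss_norm :: "complex \<Rightarrow> real" where
  "gauss_norm \<nu> = (cmod \<nu>)\<^sup>2"

definition ideal_dvd :: "complex set \<Rightarrow> complex set \<Rightarrow> bool" where
  "ideal_dvd I J \<longleftrightarrow> (\<exists>L. ideal L gauss_ring \<and> J = ideal_prod gauss_ring I L)"

text \<open>
  The set of ideals dividing the principal ideal \<open>(\<nu>)\<close>; it is finite for \<open>\<nu> \<noteq> 0\<close>.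
\<close>

definition ideal_divisors :: "complex \<Rightarrow> complex set set" where
  "ideal_divisors \<nu> = {I. ideal I gauss_ring \<and> ideal_dvd I (PIdl\<^bsub>gauss_ring\<^esub> \<nu>)}"

definition tau :: "complex \<Rightarrow> nat" where
  "tau \<nu> = card (ideal_divisors \<nu>)"

text \<open>
  The absolute norm of a nonzero ideal is its index in the ring; for a principal ideal
  \<open>(\<delta>)\<close> this is the norm of the generator \<open>\<delta>\<close>.
\<close>

definition ideal_norm :: "complex set \<Rightarrow> nat" where
  "ideal_norm I = card (carrier (gauss_ring Quot I))"

definition sigma_minus_one :: "complex \<Rightarrow> real" where
  "sigma_minus_one \<kappa> = (\<Sum>I\<in>ideal_divisors \<kappa>. 1 / real (ideal_norm I))"

text \<open>
  The Dedekind zeta function of \<open>\<rat>(i)\<close>, whose ring of integers is \<open>\<int>[i]\<close>, in its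
  half-plane of absolute convergence \<open>Re s > 1\<close>. The type is polymorphic so that the
  argument may be real or complex.
\<close>

definition zeta_K :: "'a::{real_normed_field, ln} \<Rightarrow> 'a" where
  "zeta_K s = (\<Sum>\<^sub>\<infinity>I\<in>{I. ideal I gauss_ring \<and> I \<noteq> {0}}. of_nat (ideal_norm I) powr (- s))"

end

theory Submission
  imports Defs
begin

text \<open>
  The proof is the elementary hyperbola-method proof of Ingham's theorem on
  \<open>\<Sum> d(n) d(n + k)\<close>, carried over to \<open>\<int>[i]\<close>. Put \<open>y = \<surd>x\<close>. A divisor of \<open>\<nu>\<close> of norm
  greater than \<open>y\<close> has a cofactor of norm less than about \<open>y\<close>, so up to units \<open>\<tau>(\<nu>)\<close> is twice the number of
  divisors of norm at most \<open>y\<close>, with an error controlled by the divisors of norm between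
  \<open>N \<nu> / (4 y)\<close> and \<open>4 y\<close> (\<open>divisor_hyperbola\<close>). That error contributes only \<open>O(x log x)\<close>
  on average (\<open>sum_middle_small_divisors\<close>).

  What remains is to count, for each pair \<open>(\<alpha>, \<gamma>)\<close> of norms at most \<open>y\<close>, the \<open>\<nu>\<close> in the disc
  \<open>N \<nu> \<le> x\<close> with \<open>\<alpha> | \<nu>\<close> and \<open>\<gamma> | \<nu> + \<kappa>\<close>. There are none unless the gcd \<open>g\<close> of the
  pair divides \<open>\<kappa>\<close>; otherwise they form a residue class modulo \<open>\<alpha>\<gamma>/g\<close>
  (\<open>shifted_multiples_residue_class\<close>), and comparing the lattice with the area of the disc gives
  \<open>\<pi> x N(g) / (N(\<alpha>) N(\<gamma>))\<close> up to the length of the boundary. The modulus has norm at most \<open>x\<close>, so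
  the boundary terms are small enough to sum to \<open>O(x log x)\<close> (\<open>sum_small_divisors\<close>).

  The main term is thus \<open>\<pi> x\<close> times the sum of \<open>N(g) / (N(\<alpha>) N(\<gamma>))\<close> over the pairs with
  \<open>g | \<kappa>\<close>. Grouping pairs by their gcd expresses it through the sum \<open>C(z)\<close> of
  \<open>1 / (N(\<alpha>) N(\<gamma>))\<close> over coprime pairs of norm at most \<open>z\<close>, evaluated at the points
  \<open>y / N(g)\<close>. The function \<open>C\<close> varies slowly: replacing \<open>C(z / N(g))\<close> by \<open>C(z)\<close> costs
  \<open>O(log z log N(g))\<close>, which is harmless after summation over \<open>g\<close>
  (\<open>sum_pairs_gcd_asymp\<close>). The main term is therefore \<open>\<sigma>\<^sub>-\<^sub>1(\<kappa>) C(y)\<close>, and the same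
  argument applied to all pairs, whose sum is \<open>(\<pi> log y + O(1))\<^sup>2\<close>, gives
  \<open>\<zeta>\<^sub>K(2) C(y) = \<pi>\<^sup>2 (log y)\<^sup>2 + O(log y)\<close>. The zeta value thus appears directly as a sum
  over ideals, without Moebius inversion.

  All counting is done with elements rather than ideals. A nonzero ideal has exactly four generators,
  so sums over ideals are a quarter of sums over Gaussian integers.
\<close>

section \<open>Gaussian integers and their norm\<close>

lemma gauss_ints_Complex_iff: "z \<in> gauss_ints \<longleftrightarrow> (\<exists>(a::int) (b::int). z = Complex a b)"
  by (cases z) (auto simp: gauss_ints_def Ints_def)

lemma gauss_ints_intros [intro, simp]:
  "0 \<in> gauss_ints" "1 \<in> gauss_ints" "\<i> \<in> gauss_ints"
  "a \<in> gauss_ints \<Longrightarrow> - a \<in> gauss_ints"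
  "a \<in> gauss_ints \<Longrightarrow> cnj a \<in> gauss_ints"
  "a \<in> gauss_ints \<Longrightarrow> b \<in> gauss_ints \<Longrightarrow> a + b \<in> gauss_ints"
  "a \<in> gauss_ints \<Longrightarrow> b \<in> gauss_ints \<Longrightarrow> a - b \<in> gauss_ints"
  "a \<in> gauss_ints \<Longrightarrow> b \<in> gauss_ints \<Longrightarrow> a * b \<in> gauss_ints"
  by (auto simp: gauss_ints_def)

lemma gauss_norm_altdef: "gauss_norm z = (Re z)\<^sup>2 + (Im z)\<^sup>2"
  by (simp add: gauss_norm_def cmod_power2)

lemma gauss_norm_nonneg [simp]: "gauss_norm z \<ge> 0"
  by (simp add: gauss_norm_def)

lemma gauss_norm_eq_0_iff [simp]: "gauss_norm z = 0 \<longleftrightarrow> z = 0"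
  by (simp add: gauss_norm_def)

lemma gauss_norm_pos_iff [simp]: "gauss_norm z > 0 \<longleftrightarrow> z \<noteq> 0"
  by (simp add: gauss_norm_def)

lemma gauss_norm_0 [simp]: "gauss_norm 0 = 0"
  by simp

lemma gauss_norm_mult [simp]: "gauss_norm (a * b) = gauss_norm a * gauss_norm b"
  by (simp add: gauss_norm_def norm_mult power_mult_distrib)

lemma gauss_norm_divide: "gauss_norm (a / b) = gauss_norm a / gauss_norm b"
  by (simp add: gauss_norm_def norm_divide power_divide)

lemma sqrt_gauss_norm [simp]: "sqrt (gauss_norm a) = cmod a"
  by (simp add: gauss_norm_def)

lemma gauss_norm_le_iff: "x \<ge> 0 \<Longrightarrow> gauss_norm a \<le> x \<longleftrightarrow> cmod a \<le> sqrt x"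
  unfolding gauss_norm_def using real_le_rsqrt sqrt_ge_absD by fastforce

lemma gauss_norm_nat: "z \<in> gauss_ints \<Longrightarrow> \<exists>n::nat. gauss_norm z = real n"
proof -
  assume "z \<in> gauss_ints"
  then obtain a b :: int where z: "z = Complex a b"
    by (auto simp: gauss_ints_Complex_iff)
  have "gauss_norm z = real (nat (a\<^sup>2 + b\<^sup>2))"
    by (simp add: z gauss_norm_altdef)
  thus ?thesis by blast
qed

lemma gauss_norm_ge_1: "z \<in> gauss_ints \<Longrightarrow> z \<noteq> 0 \<Longrightarrow> gauss_norm z \<ge> 1"
  using gauss_norm_nat[of z] by (metis gauss_norm_eq_0_iff less_one linorder_not_less of_nat_0 of_nat_1 of_nat_le_iff)

lemma gauss_norm_1 [simp]: "gauss_norm 1 = 1"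
  by (simp add: gauss_norm_def)

lemma finite_gauss_ints_cball: "finite {z \<in> gauss_ints. cmod (z - c) \<le> R}"
proof -
  define M where "M = \<lceil>cmod c + \<bar>R\<bar>\<rceil>"
  have "{z \<in> gauss_ints. cmod (z - c) \<le> R} \<subseteq> (\<lambda>(a,b). Complex (of_int a) (of_int b)) ` ({-M..M} \<times> {-M..M})"
  proof
    fix z assume z: "z \<in> {z \<in> gauss_ints. cmod (z - c) \<le> R}"
    then obtain a b :: int where ab: "z = Complex a b"
      by (auto simp: gauss_ints_Complex_iff)
    have "cmod z \<le> cmod c + \<bar>R\<bar>"
      using z norm_triangle_ineq[of "z - c" c] by auto
    also have "\<dots> \<le> M" by (simp add: M_def)
    finally have le: "cmod z \<le> M" .
    have "\<bar>real_of_int a\<bar> \<le> M" "\<bar>real_of_int b\<bar> \<le> M"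
      using le abs_Re_le_cmod[of z] abs_Im_le_cmod[of z] by (auto simp: ab)
    hence "a \<in> {-M..M}" "b \<in> {-M..M}" by auto
    thus "z \<in> (\<lambda>(a,b). Complex (of_int a) (of_int b)) ` ({-M..M} \<times> {-M..M})"
      using ab by force
  qed
  thus ?thesis by (rule finite_subset) auto
qed

lemma finite_gauss_ints_norm_le: "finite {z \<in> gauss_ints. gauss_norm z \<le> x}"
proof (cases "x \<ge> 0")
  case True
  thus ?thesis using finite_gauss_ints_cball[of 0 "sqrt x"]
    by (simp add: gauss_norm_le_iff)
next
  case False
  have "{z \<in> gauss_ints. gauss_norm z \<le> x} = {}"
    using False by (auto simp: not_le intro: less_le_trans[OF _ gauss_norm_nonneg])
  thus ?thesis by (metis finite.emptyI)
qed

section \<open>Lattice points in discs\<close>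

definition unit_square :: "complex \<Rightarrow> complex set" where
  "unit_square \<mu> = cbox \<mu> (\<mu> + Complex 1 1)"

lemma measure_unit_square: "measure lebesgue (unit_square \<mu>) = 1"
proof -
  have "unit_square \<mu> \<noteq> {}"
    unfolding unit_square_def by (auto simp: box_ne_empty Basis_complex_def)
  thus ?thesis
    by (simp add: unit_square_def content_cbox' measure_completion Basis_complex_def inner_complex_def)
qed

lemma cmod_diff_le_unit_square: "z \<in> unit_square \<mu> \<Longrightarrow> cmod (z - \<mu>) \<le> 2"
  using cmod_le[of "z - \<mu>"] by (auto simp: unit_square_def in_cbox_complex_iff)

lemma negligible_unit_square_Int:
  assumes "\<mu> \<in> gauss_ints" "\<mu>' \<in> gauss_ints" "\<mu> \<noteq> \<mu>'"
  shows "negligible (unit_square \<mu> \<inter> unit_square \<mu>')"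
proof -
  have "interior (unit_square \<mu> \<inter> unit_square \<mu>') = {}"
  proof (rule ccontr)
    assume "interior (unit_square \<mu> \<inter> unit_square \<mu>') \<noteq> {}"
    then obtain z where z: "z \<in> box \<mu> (\<mu> + Complex 1 1)" "z \<in> box \<mu>' (\<mu>' + Complex 1 1)"
      by (auto simp: unit_square_def)
    obtain a b a' b' :: int where ab: "\<mu> = Complex a b" "\<mu>' = Complex a' b'"
      using assms by (auto simp: gauss_ints_Complex_iff)
    have "a = \<lfloor>Re z\<rfloor>" "b = \<lfloor>Im z\<rfloor>" "a' = \<lfloor>Re z\<rfloor>" "b' = \<lfloor>Im z\<rfloor>"
      using z by (auto simp: in_box_complex_iff ab intro!: floor_unique[symmetric])
    thus False using assms ab by simp
  qed
  moreover have "convex (unit_square \<mu> \<inter> unit_square \<mu>')"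
    by (auto simp: unit_square_def intro: convex_Int)
  ultimately show ?thesis by (simp add: negligible_convex_interior)
qed

lemma measure_complex_cball: "r \<ge> 0 \<Longrightarrow> measure lebesgue (cball (c::complex) r) = pi * r\<^sup>2"
  by (simp add: content_cball unit_ball_vol_2)

text \<open>
  The unit squares with lower left corner at a lattice point of the disc have total area equal to the number
  of these points. Each square lies within distance 2 of its corner, so their union is squeezed between
  the concentric discs of radius \<open>R - 2\<close> and \<open>R + 2\<close>. The centre is arbitrary because
  residue classes are counted by translating and rescaling them to \<open>\<int>[i]\<close>.
\<close>

lemma card_gauss_ints_cball:
  assumes "R \<ge> 0"
  shows "\<bar>real (card {\<mu> \<in> gauss_ints. cmod (\<mu> - c) \<le> R}) - pi * R\<^sup>2\<bar> \<le> 4 * pi * (R + 1)"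
proof -
  define S where "S = {\<mu> \<in> gauss_ints. cmod (\<mu> - c) \<le> R}"
  define U where "U = (\<Union>\<mu>\<in>S. unit_square \<mu>)"
  have fin: "finite S" unfolding S_def by (rule finite_gauss_ints_cball)
  have Um: "U \<in> lmeasurable"
    unfolding U_def using fin by (intro fmeasurable.finite_UN) (auto simp: unit_square_def)
  have "measure lebesgue U = (\<Sum>\<mu>\<in>S. measure lebesgue (unit_square \<mu>))"
    unfolding U_def
    by (intro measure_negligible_finite_Union_image fin pairwiseI negligible_unit_square_Int)
       (auto simp: S_def unit_square_def)
  hence mU: "measure lebesgue U = real (card S)"
    by (simp add: measure_unit_square)
  have "U \<subseteq> cball c (R + 2)"
  proof
    fix z assume "z \<in> U"
    then obtain \<mu> where mu: "\<mu> \<in> S" "z \<in> unit_square \<mu>" by (auto simp: U_def)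
    have "cmod (z - c) \<le> cmod (z - \<mu>) + cmod (\<mu> - c)"
      using norm_triangle_ineq[of "z - \<mu>" "\<mu> - c"] by simp
    also have "\<dots> \<le> 2 + R"
      using mu cmod_diff_le_unit_square by (intro add_mono) (auto simp: S_def)
    finally show "z \<in> cball c (R + 2)" by (simp add: dist_norm norm_minus_commute)
  qed
  hence "measure lebesgue U \<le> measure lebesgue (cball c (R + 2))"
    using Um by (intro measure_mono_fmeasurable) (auto simp: fmeasurableD)
  hence upper: "real (card S) \<le> pi * (R + 2)\<^sup>2"
    using assms measure_complex_cball[of "R + 2" c] by (simp add: mU)
  have lower: "real (card S) \<ge> pi * (R - 2)\<^sup>2" if "R \<ge> 2"
  proof -
    have "cball c (R - 2) \<subseteq> U"
    proof
      fix z assume z: "z \<in> cball c (R - 2)"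
      define \<mu> where "\<mu> = Complex \<lfloor>Re z\<rfloor> \<lfloor>Im z\<rfloor>"
      have mu: "\<mu> \<in> gauss_ints" "z \<in> unit_square \<mu>"
        using floor_correct[of "Re z"] floor_correct[of "Im z"]
        by (auto simp: \<mu>_def gauss_ints_def unit_square_def in_cbox_complex_iff)
      have "cmod (\<mu> - c) \<le> cmod (z - \<mu>) + cmod (z - c)"
        using norm_triangle_ineq[of "\<mu> - z" "z - c"] by (simp add: norm_minus_commute)
      also have "\<dots> \<le> 2 + (R - 2)"
        using z cmod_diff_le_unit_square[OF mu(2)]
        by (intro add_mono) (auto simp: dist_norm norm_minus_commute)
      finally show "z \<in> U" using mu by (auto simp: U_def S_def)
    qed
    hence "measure lebesgue (cball c (R - 2)) \<le> measure lebesgue U"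
      using Um by (intro measure_mono_fmeasurable) (auto simp: fmeasurableD)
    thus ?thesis using that measure_complex_cball[of "R - 2" c] by (simp add: mU)
  qed
  have "pi * R\<^sup>2 - 4 * pi * (R + 1) \<le> real (card S)"
  proof (cases "R \<ge> 2")
    case True
    have "pi * R\<^sup>2 - 4 * pi * (R + 1) \<le> pi * (R - 2)\<^sup>2"
      by (simp add: power2_eq_square algebra_simps)
    with lower[OF True] show ?thesis by linarith
  next
    case False
    \<comment> \<open>For \<open>R < 2\<close> the inner disc is empty, but the claimed lower bound is negative.\<close>
    have "R * R \<le> 2 * R" using False assms by (intro mult_right_mono) auto
    hence "pi * (R * R) \<le> pi * (4 * (R + 1))" using assms by (intro mult_left_mono) auto
    hence "pi * R\<^sup>2 - 4 * pi * (R + 1) \<le> 0" by (simp add: power2_eq_square algebra_simps)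
    thus ?thesis using of_nat_0_le_iff order_trans by blast
  qed
  moreover have "pi * (R + 2)\<^sup>2 = pi * R\<^sup>2 + 4 * pi * (R + 1)"
    by (simp add: power2_eq_square algebra_simps)
  ultimately show ?thesis using upper unfolding S_def by linarith
qed

definition gdvd :: "complex \<Rightarrow> complex \<Rightarrow> bool" where
  "gdvd a b \<longleftrightarrow> (\<exists>c\<in>gauss_ints. b = a * c)"

text \<open>
  The substitution \<open>\<nu> = r + \<theta> \<mu>\<close> maps \<open>\<int>[i]\<close> onto the class and shrinks the disc by the
  factor \<open>|\<theta>|\<close>.
\<close>

lemma card_residue_class:
  assumes "\<theta> \<in> gauss_ints" "\<theta> \<noteq> 0" "r \<in> gauss_ints" "x \<ge> 0"
  shows "\<bar>real (card {\<nu> \<in> gauss_ints. gdvd \<theta> (\<nu> - r) \<and> gauss_norm \<nu> \<le> x}) - pi * x / gauss_norm \<theta>\<bar>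
           \<le> 4 * pi * (sqrt (x / gauss_norm \<theta>) + 1)"
proof -
  define R where "R = sqrt (x / gauss_norm \<theta>)"
  have le_iff: "gauss_norm (r + \<theta> * \<mu>) \<le> x \<longleftrightarrow> cmod (\<mu> - (- r / \<theta>)) \<le> R" for \<mu>
  proof -
    have "r + \<theta> * \<mu> = \<theta> * (\<mu> - (- r / \<theta>))"
      using assms by (simp add: field_simps)
    hence "gauss_norm (r + \<theta> * \<mu>) = gauss_norm \<theta> * gauss_norm (\<mu> - (- r / \<theta>))"
      by (metis gauss_norm_mult)
    moreover have "gauss_norm (\<mu> - (- r / \<theta>)) \<le> x / gauss_norm \<theta> \<longleftrightarrow> cmod (\<mu> - (- r / \<theta>)) \<le> R"
      unfolding R_def using assms by (intro gauss_norm_le_iff) auto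
    ultimately show ?thesis using assms by (simp add: field_simps)
  qed
  have "bij_betw (\<lambda>\<mu>. r + \<theta> * \<mu>) {\<mu> \<in> gauss_ints. cmod (\<mu> - (- r / \<theta>)) \<le> R}
          {\<nu> \<in> gauss_ints. gdvd \<theta> (\<nu> - r) \<and> gauss_norm \<nu> \<le> x}"
    unfolding bij_betw_def
  proof (intro conjI)
    show "inj_on (\<lambda>\<mu>. r + \<theta> * \<mu>) {\<mu> \<in> gauss_ints. cmod (\<mu> - (- r / \<theta>)) \<le> R}"
      using assms by (auto intro: inj_onI)
    show "(\<lambda>\<mu>. r + \<theta> * \<mu>) ` {\<mu> \<in> gauss_ints. cmod (\<mu> - (- r / \<theta>)) \<le> R} =
            {\<nu> \<in> gauss_ints. gdvd \<theta> (\<nu> - r) \<and> gauss_norm \<nu> \<le> x}"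
    proof (intro equalityI subsetI)
      fix \<nu> assume nu: "\<nu> \<in> {\<nu> \<in> gauss_ints. gdvd \<theta> (\<nu> - r) \<and> gauss_norm \<nu> \<le> x}"
      then obtain \<mu> where mu: "\<mu> \<in> gauss_ints" "\<nu> - r = \<theta> * \<mu>" by (auto simp: gdvd_def)
      have "\<nu> = r + \<theta> * \<mu>" using mu(2) by (simp add: algebra_simps)
      thus "\<nu> \<in> (\<lambda>\<mu>. r + \<theta> * \<mu>) ` {\<mu> \<in> gauss_ints. cmod (\<mu> - (- r / \<theta>)) \<le> R}"
        using nu mu(1) le_iff by auto
    next
      fix \<nu> assume "\<nu> \<in> (\<lambda>\<mu>. r + \<theta> * \<mu>) ` {\<mu> \<in> gauss_ints. cmod (\<mu> - (- r / \<theta>)) \<le> R}"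
      thus "\<nu> \<in> {\<nu> \<in> gauss_ints. gdvd \<theta> (\<nu> - r) \<and> gauss_norm \<nu> \<le> x}"
        using assms le_iff by (auto simp: gdvd_def)
    qed
  qed
  hence card: "card {\<nu> \<in> gauss_ints. gdvd \<theta> (\<nu> - r) \<and> gauss_norm \<nu> \<le> x} =
         card {\<mu> \<in> gauss_ints. cmod (\<mu> - (- r / \<theta>)) \<le> R}"
    by (simp add: bij_betw_same_card)
  have area: "pi * x / gauss_norm \<theta> = pi * R\<^sup>2"
    using assms by (simp add: R_def)
  have "R \<ge> 0" using assms by (simp add: R_def)
  from card_gauss_ints_cball[OF this, of "- r / \<theta>"] show ?thesis
    unfolding card area R_def[symmetric] .
qed

text \<open>
  The boundary term is absorbed by the arithmetic-geometric mean inequality. This form suffices whenever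
  only the order of magnitude counts.
\<close>

lemma card_residue_class_le:
  assumes "\<theta> \<in> gauss_ints" "\<theta> \<noteq> 0" "r \<in> gauss_ints" "x \<ge> 0"
  shows "real (card {\<nu> \<in> gauss_ints. gdvd \<theta> (\<nu> - r) \<and> gauss_norm \<nu> \<le> x})
           \<le> 8 * pi * (x / gauss_norm \<theta> + 1)"
proof -
  define t where "t = x / gauss_norm \<theta>"
  have t: "t \<ge> 0" using assms by (simp add: t_def)
  have "sqrt t \<le> (t + 1) / 2"
    using arith_geo_mean_sqrt[of t 1] t by simp
  hence "pi * t + 4 * pi * (sqrt t + 1) \<le> pi * t + 4 * pi * ((t + 1) / 2 + 1)"
    by (intro add_left_mono mult_left_mono) auto
  also have "\<dots> \<le> 8 * pi * (t + 1)"
    using t by (simp add: algebra_simps)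
  finally have "pi * t + 4 * pi * (sqrt t + 1) \<le> 8 * pi * (t + 1)" .
  thus ?thesis using card_residue_class[OF assms] unfolding t_def abs_le_iff by simp
qed

section \<open>Sums over the Gaussian integers of bounded norm\<close>

definition gdisc :: "real \<Rightarrow> complex set" where
  "gdisc z = {\<alpha> \<in> gauss_ints. \<alpha> \<noteq> 0 \<and> gauss_norm \<alpha> \<le> z}"

definition recip_norm_sum :: "real \<Rightarrow> real" where
  "recip_norm_sum z = (\<Sum>\<alpha>\<in>gdisc z. 1 / gauss_norm \<alpha>)"

lemma finite_gdisc [simp]: "finite (gdisc z)"
  by (rule finite_subset[OF _ finite_gauss_ints_norm_le[of z]]) (auto simp only: gdisc_def)

lemma gdiscD:
  assumes "\<alpha> \<in> gdisc z"
  shows "\<alpha> \<in> gauss_ints" "\<alpha> \<noteq> 0" "gauss_norm \<alpha> \<le> z" "gauss_norm \<alpha> > 0" "gauss_norm \<alpha> \<ge> 1"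
  using assms gauss_norm_ge_1 by (auto simp: gdisc_def)

lemma gdisc_mono: "z \<le> z' \<Longrightarrow> gdisc z \<subseteq> gdisc z'"
  by (auto simp: gdisc_def)

lemma gdisc_empty: "z < 1 \<Longrightarrow> gdisc z = {}"
  using gauss_norm_ge_1 by (fastforce simp: gdisc_def)

lemma gdisc_floor: "z \<ge> 0 \<Longrightarrow> gdisc z = gdisc (real (nat \<lfloor>z\<rfloor>))"
proof -
  assume z: "z \<ge> 0"
  have "gauss_norm \<alpha> \<le> z \<longleftrightarrow> gauss_norm \<alpha> \<le> real (nat \<lfloor>z\<rfloor>)" if "\<alpha> \<in> gauss_ints" for \<alpha>
  proof -
    from gauss_norm_nat[OF that] obtain n :: nat where "gauss_norm \<alpha> = real n" ..
    moreover have "real n \<le> z \<longleftrightarrow> int n \<le> \<lfloor>z\<rfloor>" by (simp add: le_floor_iff)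
    moreover have "real n \<le> real (nat \<lfloor>z\<rfloor>) \<longleftrightarrow> int n \<le> \<lfloor>z\<rfloor>"
      using z unfolding of_nat_le_iff by (subst le_nat_iff) auto
    ultimately show ?thesis by simp
  qed
  thus ?thesis by (auto simp: gdisc_def)
qed

lemma card_gdisc:
  assumes "z \<ge> 1"
  shows "\<bar>real (card (gdisc z)) - pi * z\<bar> \<le> 9 * pi * sqrt z"
proof -
  \<comment> \<open>The origin is the one lattice point of the disc that is left out; it costs \<open>1 \<le> \<pi> \<surd>z\<close>.\<close>
  have eq: "{\<mu> \<in> gauss_ints. cmod (\<mu> - 0) \<le> sqrt z} = insert 0 (gdisc z)"
    using assms by (auto simp: gdisc_def gauss_norm_le_iff)
  have "card {\<mu> \<in> gauss_ints. cmod (\<mu> - 0) \<le> sqrt z} = card (gdisc z) + 1"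
    unfolding eq by (subst card_insert_disjoint) (simp_all, simp add: gdisc_def)
  moreover have "pi * sqrt z \<ge> pi" using assms by simp
  moreover have "pi * sqrt z \<ge> 1"
    using mult_mono[of 1 pi 1 "sqrt z"] assms pi_ge_two by simp
  moreover have "\<bar>real (card {\<mu> \<in> gauss_ints. cmod (\<mu> - 0) \<le> sqrt z}) - pi * z\<bar> \<le> 4 * (pi * sqrt z) + 4 * pi"
    using card_gauss_ints_cball[of "sqrt z" 0] assms by (simp add: algebra_simps)
  ultimately show ?thesis by linarith
qed

lemma card_gdisc_le: "z \<ge> 0 \<Longrightarrow> real (card (gdisc z)) \<le> 10 * pi * z"
proof (cases "z \<ge> 1")
  case True
  have "sqrt z * 1 \<le> sqrt z * sqrt z" using True by (intro mult_left_mono) auto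
  hence "pi * sqrt z \<le> pi * z" using True by (intro mult_left_mono) auto
  moreover have "real (card (gdisc z)) \<le> pi * z + 9 * pi * sqrt z"
    using card_gdisc[OF True] by linarith
  ultimately show ?thesis by linarith
next
  case False
  moreover assume "z \<ge> 0"
  ultimately show ?thesis by (simp add: gdisc_empty)
qed

lemma sqrt_div_sq_eq_powr: "t > 0 \<Longrightarrow> sqrt t / t\<^sup>2 = t powr (-3/2)"
  using powr_diff[of t "1/2" 2] by (simp add: powr_half_sqrt)

text \<open>
  Summation by parts. Norms are natural numbers, so a function of the norm is represented by a sequence
  and the floor loses nothing.
\<close>

lemma sum_gdisc_partial_summation:
  fixes f :: "nat \<Rightarrow> real"
  shows "(\<Sum>\<alpha>\<in>gdisc (real n). f (nat \<lfloor>gauss_norm \<alpha>\<rfloor>)) =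
           real (card (gdisc (real n))) * f (Suc n) +
           (\<Sum>k=1..n. real (card (gdisc (real k))) * (f k - f (Suc k)))"
proof (induction n)
  case 0
  show ?case by (simp add: gdisc_empty)
next
  case (Suc n)
  define new where "new = gdisc (real (Suc n)) - gdisc (real n)"
  have sub: "gdisc (real n) \<subseteq> gdisc (real (Suc n))" by (rule gdisc_mono) simp
  have new: "nat \<lfloor>gauss_norm \<alpha>\<rfloor> = Suc n" if "\<alpha> \<in> new" for \<alpha>
  proof -
    have "\<alpha> \<in> gauss_ints" using that by (auto simp: new_def gdisc_def)
    then obtain k :: nat where "gauss_norm \<alpha> = real k"
      using gauss_norm_nat by blast
    thus ?thesis using that by (auto simp: new_def gdisc_def)
  qed
  have "(\<Sum>\<alpha>\<in>gdisc (real (Suc n)). f (nat \<lfloor>gauss_norm \<alpha>\<rfloor>)) =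
        (\<Sum>\<alpha>\<in>new. f (nat \<lfloor>gauss_norm \<alpha>\<rfloor>)) + (\<Sum>\<alpha>\<in>gdisc (real n). f (nat \<lfloor>gauss_norm \<alpha>\<rfloor>))"
    unfolding new_def using sub by (intro sum.subset_diff) auto
  also have "(\<Sum>\<alpha>\<in>new. f (nat \<lfloor>gauss_norm \<alpha>\<rfloor>)) = real (card new) * f (Suc n)"
    using new by simp
  also have "real (card new) = real (card (gdisc (real (Suc n)))) - real (card (gdisc (real n)))"
    unfolding new_def using sub by (simp add: card_Diff_subset card_mono of_nat_diff del: of_nat_Suc)
  finally show ?case unfolding Suc.IH by (simp add: algebra_simps del: of_nat_Suc)
qed

lemma sum_gdisc_eq_nat:
  "(\<Sum>\<alpha>\<in>gdisc z. f (gauss_norm \<alpha>)) = (\<Sum>\<alpha>\<in>gdisc z. f (real (nat \<lfloor>gauss_norm \<alpha>\<rfloor>)))"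
proof (rule sum.cong)
  fix \<alpha> assume "\<alpha> \<in> gdisc z"
  then obtain k :: nat where "gauss_norm \<alpha> = real k" using gauss_norm_nat gdiscD(1) by blast
  thus "f (gauss_norm \<alpha>) = f (real (nat \<lfloor>gauss_norm \<alpha>\<rfloor>))" by simp
qed simp

text \<open>
  The number of points of norm at most \<open>k\<close> is at most a constant times \<open>k\<close>. Inserting this bound after
  summation by parts, which is legitimate for decreasing \<open>f\<close>, and then undoing the summation by parts
  compares the sum with the one in which every natural number is a norm exactly once.
\<close>

lemma sum_gdisc_le_sum_nat:
  fixes f :: "real \<Rightarrow> real"
  assumes f: "\<And>k. k \<ge> 1 \<Longrightarrow> f (real (Suc k)) \<le> f (real k)" "\<And>k. f (real k) \<ge> 0"
  shows "(\<Sum>\<alpha>\<in>gdisc (real n). f (gauss_norm \<alpha>)) \<le> 10 * pi * (\<Sum>k=1..n. f (real k))"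
proof -
  have tele: "real n * f (real (Suc n)) + (\<Sum>k=1..n. real k * (f (real k) - f (real (Suc k))))
                = (\<Sum>k=1..n. f (real k))"
    by (induction n) (auto simp: algebra_simps)
  have "(\<Sum>\<alpha>\<in>gdisc (real n). f (gauss_norm \<alpha>)) =
           real (card (gdisc (real n))) * f (real (Suc n)) +
           (\<Sum>k=1..n. real (card (gdisc (real k))) * (f (real k) - f (real (Suc k))))"
    unfolding sum_gdisc_eq_nat by (rule sum_gdisc_partial_summation)
  also have "\<dots> \<le> 10 * pi * real n * f (real (Suc n)) +
           (\<Sum>k=1..n. 10 * pi * real k * (f (real k) - f (real (Suc k))))"
    using f f(2)[of "Suc n"] by (intro add_mono sum_mono mult_right_mono card_gdisc_le) auto
  also have "\<dots> = 10 * pi * (real n * f (real (Suc n)) +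
      (\<Sum>k=1..n. real k * (f (real k) - f (real (Suc k)))))"
    by (simp add: sum_distrib_left algebra_simps)
  also note tele
  finally show ?thesis .
qed

text \<open>
  In the summation by parts, the main term \<open>\<pi> k\<close> of the number of points of norm at most \<open>k\<close>
  yields \<open>\<pi>\<close> times a harmonic sum, and its error \<open>O(\<surd>k)\<close> is divided by \<open>k (k + 1)\<close>, so it
  yields a convergent series.
\<close>

lemma recip_norm_sum_asymp:
  obtains K where "K \<ge> 0" "\<And>z. z \<ge> 1 \<Longrightarrow> \<bar>recip_norm_sum z - pi * ln z\<bar> \<le> K"
proof -
  define s where "s = (\<Sum>k. real k powr (-3/2))"
  have summ: "summable (\<lambda>k. real k powr (-3/2))"
    by (subst summable_real_powr_iff) auto
  have s0: "s \<ge> 0" unfolding s_def by (intro suminf_nonneg summ) auto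
  have main: "\<bar>recip_norm_sum (real n) - pi * ln (real n)\<bar> \<le> 10 * pi + 9 * pi * s + 2 * pi" if n: "n \<ge> 1" for n
  proof -
    define P where "P = (\<lambda>k::nat. real (card (gdisc (real k))))"
    define E where "E = (\<Sum>k=1..n. (P k - pi * real k) * (1 / real k - 1 / real (Suc k)))"
    have "recip_norm_sum (real n) = P n / real (Suc n) + (\<Sum>k=1..n. P k * (1 / real k - 1 / real (Suc k)))"
      unfolding recip_norm_sum_def P_def sum_gdisc_eq_nat[where f = "\<lambda>x. 1 / x"]
      using sum_gdisc_partial_summation[of "\<lambda>k. 1 / real k" n] by simp
    also have "(\<Sum>k=1..n. P k * (1 / real k - 1 / real (Suc k))) =
               (\<Sum>k=1..n. pi * real k * (1 / real k - 1 / real (Suc k))) + E"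
      unfolding E_def sum.distrib[symmetric] by (intro sum.cong) (auto simp: algebra_simps)
    also have "(\<Sum>k=1..n. pi * real k * (1 / real k - 1 / real (Suc k))) = (\<Sum>k=1..n. pi / real (Suc k))"
    proof (intro sum.cong refl)
      fix k assume "k \<in> {1..n}"
      hence "1 / real k - 1 / real (Suc k) = 1 / (real k * real (Suc k))" by (simp add: field_simps)
      thus "pi * real k * (1 / real k - 1 / real (Suc k)) = pi / real (Suc k)"
        using \<open>k \<in> {1..n}\<close> by simp
    qed
    also have "\<dots> = pi * (harm (Suc n) - 1)"
    proof -
      have "(\<Sum>k=1..n. pi / real (Suc k)) = pi * (harm (Suc n) - 1)" for n :: nat
      proof (induction n)
        case 0
        thus ?case by (simp add: harm_Suc harm_def)
      next
        case (Suc n)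
        have "(\<Sum>k=1..Suc n. pi / real (Suc k)) = pi * (harm (Suc n) - 1) + pi / real (Suc (Suc n))"
          using Suc by simp
        also have "\<dots> = pi * (harm (Suc (Suc n)) - 1)"
          by (simp only: harm_Suc[of "Suc n"] divide_inverse ring_distribs)
        finally show ?case .
      qed
      thus ?thesis .
    qed
    finally have eq: "recip_norm_sum (real n) - pi * ln (real n) =
        P n / real (Suc n) + E + pi * (harm (Suc n) - 1 - ln (real n))" by (simp add: algebra_simps)
    have "\<bar>E\<bar> \<le> (\<Sum>k=1..n. \<bar>(P k - pi * real k) * (1 / real k - 1 / real (Suc k))\<bar>)"
      unfolding E_def by (rule sum_abs)
    also have "\<dots> \<le> (\<Sum>k=1..n. 9 * pi * real k powr (-3/2))"
    proof (intro sum_mono)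
      fix k assume k: "k \<in> {1..n}"
      have d: "1 / real k - 1 / real (Suc k) \<ge> 0" using k by (simp add: field_simps)
      have "1 / real k - 1 / real (Suc k) = 1 / (real k * real (Suc k))"
        using k by (simp add: field_simps)
      also have "\<dots> \<le> 1 / (real k * real k)"
        using k by (intro divide_left_mono mult_left_mono) auto
      finally have d': "1 / real k - 1 / real (Suc k) \<le> 1 / (real k * real k)" .
      have "\<bar>(P k - pi * real k) * (1 / real k - 1 / real (Suc k))\<bar> =
            \<bar>P k - pi * real k\<bar> * (1 / real k - 1 / real (Suc k))"
        using d by (simp add: abs_mult)
      also have "\<dots> \<le> 9 * pi * sqrt (real k) * (1 / (real k * real k))"
        using k d d' card_gdisc[of "real k"] unfolding P_def by (intro mult_mono) auto
      also have "9 * pi * sqrt (real k) * (1 / (real k * real k)) = 9 * pi * (sqrt (real k) / (real k)\<^sup>2)"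
        by (simp add: power2_eq_square)
      also have "sqrt (real k) / (real k)\<^sup>2 = real k powr (-3/2)"
        using k by (intro sqrt_div_sq_eq_powr) auto
      finally show "\<bar>(P k - pi * real k) * (1 / real k - 1 / real (Suc k))\<bar> \<le> 9 * pi * real k powr (-3/2)" .
    qed
    also have "\<dots> = 9 * pi * (\<Sum>k=1..n. real k powr (-3/2))" by (simp add: sum_distrib_left)
    also have "\<dots> \<le> 9 * pi * s"
      unfolding s_def by (intro mult_left_mono sum_le_suminf summ) auto
    finally have E: "\<bar>E\<bar> \<le> 9 * pi * s" .
    have P: "0 \<le> P n / real (Suc n)" "P n / real (Suc n) \<le> 10 * pi"
    proof -
      have "P n \<le> 10 * pi * real n" unfolding P_def by (rule card_gdisc_le) simp
      also have "\<dots> \<le> 10 * pi * real (Suc n)" by simp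
      finally show "P n / real (Suc n) \<le> 10 * pi" by (simp add: field_simps)
    qed (simp add: P_def)
    have h1: "harm (Suc n) \<le> 1 + ln (real n) + (1::real)"
    proof -
      have "harm (Suc n) = harm n + 1 / real (Suc n)" by (simp add: harm_Suc divide_inverse)
      moreover have "harm n - ln (real n) \<le> harm (1::nat) - ln (real 1)"
      proof -
        have "harm (Suc (n-1)) - ln (real (Suc (n-1))) \<le> harm (Suc 0) - ln (real (Suc 0))"
          using decseq_harm_diff_ln unfolding decseq_def by blast
        thus ?thesis using n by simp
      qed
      moreover have "1 / real (Suc n) \<le> 1" by simp
      moreover have "harm (1::nat) = (1::real)" by (simp add: harm_def)
      ultimately show ?thesis unfolding of_nat_1 ln_one by linarith
    qed
    have h2: "harm (Suc n) \<ge> ln (real n)"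
      using ln_le_harm[of "Suc n"] n by (smt (verit) ln_le_cancel_iff of_nat_Suc of_nat_0_less_iff less_le_trans zero_less_one)
    have "\<bar>pi * (harm (Suc n) - 1 - ln (real n))\<bar> \<le> pi * 1"
      unfolding abs_mult using h1 h2 by (intro mult_mono) auto
    thus ?thesis using eq E P by linarith
  qed
  show ?thesis
  proof
    show "10 * pi + 9 * pi * s + 2 * pi + pi * ln 2 \<ge> 0" using s0 by simp
    fix z :: real assume z: "z \<ge> 1"
    define n where "n = nat \<lfloor>z\<rfloor>"
    have n: "n \<ge> 1" "real n \<le> z" "z \<le> real n + 1"
      using z by (auto simp: n_def le_nat_iff)
    have eq: "recip_norm_sum z = recip_norm_sum (real n)"
      using gdisc_floor[of z] z by (simp add: recip_norm_sum_def n_def)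
    have "ln z \<le> ln (2 * real n)" using n z by simp
    hence l1: "ln z \<le> ln 2 + ln (real n)" using n by (simp add: ln_mult)
    have l2: "ln (real n) \<le> ln z" using n by simp
    have "\<bar>pi * ln z - pi * ln (real n)\<bar> = pi * (ln z - ln (real n))"
      using l2 by (simp add: abs_mult right_diff_distrib[symmetric])
    also have "\<dots> \<le> pi * ln 2" using l1 by (intro mult_left_mono) auto
    finally show "\<bar>recip_norm_sum z - pi * ln z\<bar> \<le> 10 * pi + 9 * pi * s + 2 * pi + pi * ln 2"
      using main[OF n(1)] unfolding eq by linarith
  qed
qed

lemma recip_norm_sum_nonneg: "recip_norm_sum z \<ge> 0"
  unfolding recip_norm_sum_def by (intro sum_nonneg) simp_all

lemma recip_norm_sum_le:
  obtains K where "K > 0" "\<And>z. z \<ge> 1 \<Longrightarrow> recip_norm_sum z \<le> K * (ln z + 1)"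
proof -
  obtain K where K: "K \<ge> 0" "\<And>z. z \<ge> 1 \<Longrightarrow> \<bar>recip_norm_sum z - pi * ln z\<bar> \<le> K"
    using recip_norm_sum_asymp by blast
  show ?thesis
  proof
    show "K + pi > 0" using K by (simp add: add_nonneg_pos)
    fix z :: real assume z: "z \<ge> 1"
    have "recip_norm_sum z \<le> pi * ln z + K" using K(2)[OF z] by linarith
    also have "\<dots> \<le> (K + pi) * (ln z + 1)"
      using K(1) z by (simp add: algebra_simps)
    finally show "recip_norm_sum z \<le> (K + pi) * (ln z + 1)" .
  qed
qed

text \<open>
  For \<open>t \<le> z\<close> this is the difference of the two asymptotic formulas. For \<open>t > z\<close> the
  subtracted sum is empty, and \<open>log z < log t\<close> saves the bound. The uniformity in \<open>t\<close> is what
  makes the later sum over all possible gcds possible.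
\<close>

lemma recip_norm_sum_diff:
  obtains K where "K > 0"
    "\<And>z t. z \<ge> 1 \<Longrightarrow> t \<ge> 1 \<Longrightarrow> recip_norm_sum z - recip_norm_sum (z / t) \<le> K * (ln t + 1)"
proof -
  obtain K where K: "K \<ge> 0" "\<And>z. z \<ge> 1 \<Longrightarrow> \<bar>recip_norm_sum z - pi * ln z\<bar> \<le> K"
    using recip_norm_sum_asymp by blast
  obtain K' where K': "K' > 0" "\<And>z. z \<ge> 1 \<Longrightarrow> recip_norm_sum z \<le> K' * (ln z + 1)"
    using recip_norm_sum_le by blast
  show ?thesis
  proof
    show "2 * K + pi + K' > 0" using K K' by (intro add_nonneg_pos) auto
    fix z t :: real assume z: "z \<ge> 1" and t: "t \<ge> 1"
    have lt: "ln t \<ge> 0" using t by simp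
    show "recip_norm_sum z - recip_norm_sum (z / t) \<le> (2 * K + pi + K') * (ln t + 1)"
    proof (cases "t \<le> z")
      case True
      hence "z / t \<ge> 1" using t by simp
      have "recip_norm_sum z - recip_norm_sum (z / t) \<le> (pi * ln z + K) - (pi * ln (z / t) - K)"
        using K(2)[OF z] K(2)[OF \<open>z / t \<ge> 1\<close>] by linarith
      also have "\<dots> = pi * ln t + 2 * K" using z t by (simp add: ln_div algebra_simps)
      also have "\<dots> \<le> (2 * K + pi + K') * (ln t + 1)"
        using K(1) K'(1) lt by (simp add: algebra_simps)
      finally show ?thesis .
    next
      case False
      have "recip_norm_sum (z / t) \<ge> 0" by (rule recip_norm_sum_nonneg)
      hence "recip_norm_sum z - recip_norm_sum (z / t) \<le> K' * (ln z + 1)"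
        using K'(2)[OF z] by linarith
      also have "\<dots> \<le> K' * (ln t + 1)"
        using False z K'(1) by (intro mult_left_mono) auto
      also have "\<dots> \<le> (2 * K + pi + K') * (ln t + 1)"
        using K(1) K'(1) lt by (intro mult_right_mono) auto
      finally show ?thesis .
    qed
  qed
qed

text \<open>
  The logarithm is dominated by the square root of the norm, and the sum of \<open>N(g) powr (-3/2)\<close> is
  compared with the corresponding sum over the natural numbers.
\<close>

lemma summable_log_over_norm_sq:
  "(\<lambda>g. (ln (gauss_norm g) + 1) / (gauss_norm g)\<^sup>2) summable_on (gauss_ints - {0})"
proof -
  define s where "s = (\<Sum>k. real k powr (-3/2))"
  have summ: "summable (\<lambda>k. real k powr (-3/2))"
    by (subst summable_real_powr_iff) auto
  show ?thesis
  proof (rule nonneg_bdd_above_summable_on)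
    fix g assume "g \<in> gauss_ints - {0}"
    thus "(ln (gauss_norm g) + 1) / (gauss_norm g)\<^sup>2 \<ge> 0"
      using gauss_norm_ge_1[of g] by (intro divide_nonneg_nonneg add_nonneg_nonneg ln_ge_zero) auto
  next
    have "(\<Sum>g\<in>F. (ln (gauss_norm g) + 1) / (gauss_norm g)\<^sup>2) \<le> 2 * (10 * pi * s)"
      if F: "F \<in> {F. F \<subseteq> gauss_ints - {0} \<and> finite F}" for F
    proof -
      from F have F: "finite F" "F \<subseteq> gauss_ints - {0}" by auto
      \<comment> \<open>A finite set of nonzero Gaussian integers lies in some disc.\<close>
      obtain n :: nat where n: "\<And>g. g \<in> F \<Longrightarrow> gauss_norm g \<le> real n"
      proof -
        have "gauss_norm g \<le> real (nat \<lceil>\<Sum>g\<in>F. gauss_norm g\<rceil>)" if "g \<in> F" for g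
          using member_le_sum[OF that, of gauss_norm] F(1)
            real_nat_ceiling_ge[of "\<Sum>g\<in>F. gauss_norm g"] by (meson gauss_norm_nonneg order_trans)
        thus ?thesis using that by blast
      qed
      have "F \<subseteq> gdisc (real n)" using n F(2) by (auto simp: gdisc_def)
      hence "(\<Sum>g\<in>F. (ln (gauss_norm g) + 1) / (gauss_norm g)\<^sup>2) \<le>
             (\<Sum>g\<in>gdisc (real n). (ln (gauss_norm g) + 1) / (gauss_norm g)\<^sup>2)"
        by (intro sum_mono2) (auto dest!: gdiscD(5) intro!: divide_nonneg_nonneg add_nonneg_nonneg ln_ge_zero)
      also have "\<dots> \<le> (\<Sum>g\<in>gdisc (real n). 2 * gauss_norm g powr (-3/2))"
      proof (intro sum_mono)
        fix g assume "g \<in> gdisc (real n)"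
        hence g: "gauss_norm g \<ge> 1" by (rule gdiscD)
        define t where "t = gauss_norm g"
        have t: "t \<ge> 1" using g by (simp add: t_def)
        have "ln t = 2 * ln (sqrt t)" using t by (simp add: ln_sqrt)
        also have "\<dots> \<le> 2 * (sqrt t - 1)" using t by (intro mult_left_mono ln_le_minus_one) auto
        finally have "ln t + 1 \<le> 2 * sqrt t" by simp
        hence "(ln t + 1) / t\<^sup>2 \<le> 2 * sqrt t / t\<^sup>2" by (intro divide_right_mono) auto
        also have "\<dots> = 2 * (sqrt t / t\<^sup>2)" by simp
        also have "sqrt t / t\<^sup>2 = t powr (-3/2)"
          using t by (intro sqrt_div_sq_eq_powr) auto
        finally show "(ln (gauss_norm g) + 1) / (gauss_norm g)\<^sup>2 \<le> 2 * gauss_norm g powr (-3/2)"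
          by (simp add: t_def)
      qed
      also have "\<dots> = 2 * (\<Sum>g\<in>gdisc (real n). gauss_norm g powr (-3/2))"
        by (simp add: sum_distrib_left)
      also have "\<dots> \<le> 2 * (10 * pi * (\<Sum>k=1..n. real k powr (-3/2)))"
        using sum_gdisc_le_sum_nat[of "\<lambda>x. x powr (-3/2)" n] by (simp add: powr_mono2')
      also have "\<dots> \<le> 2 * (10 * pi * s)"
        unfolding s_def by (intro mult_left_mono sum_le_suminf summ) auto
      finally show ?thesis .
    qed
    thus "bdd_above ((\<lambda>F. \<Sum>g\<in>F. (ln (gauss_norm g) + 1) / (gauss_norm g)\<^sup>2) ` {F. F \<subseteq> gauss_ints - {0} \<and> finite F})"
      by (intro bdd_aboveI2)
  qed
qed

section \<open>Euclidean arithmetic\<close>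

lemma gdvd_refl [simp]: "gdvd a a"
  unfolding gdvd_def by (rule bexI[of _ 1]) auto

lemma gdvd_trans: "gdvd a b \<Longrightarrow> gdvd b c \<Longrightarrow> gdvd a c"
  unfolding gdvd_def by (metis gauss_ints_intros(8) mult.assoc)

lemma gdvd_0 [simp]: "gdvd a 0"
  unfolding gdvd_def by (rule bexI[of _ 0]) auto

lemma gdvd_0_left_iff [simp]: "gdvd 0 a \<longleftrightarrow> a = 0"
  unfolding gdvd_def by (auto intro!: bexI[of _ 0])

lemma gdvd_add: "gdvd a b \<Longrightarrow> gdvd a c \<Longrightarrow> gdvd a (b + c)"
  unfolding gdvd_def by (metis gauss_ints_intros(6) ring_class.ring_distribs(1))

lemma gdvd_uminus_iff [simp]: "gdvd a (- b) \<longleftrightarrow> gdvd a b"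
  unfolding gdvd_def by (metis gauss_ints_intros(4) minus_minus mult_minus_right)

lemma gdvd_diff: "gdvd a b \<Longrightarrow> gdvd a c \<Longrightarrow> gdvd a (b - c)"
  using gdvd_add[of a b "- c"] by simp

lemma gdvd_mult: "gdvd a b \<Longrightarrow> c \<in> gauss_ints \<Longrightarrow> gdvd a (c * b)"
  unfolding gdvd_def by (metis gauss_ints_intros(8) mult.left_commute)

lemma gdvd_triv [simp]: "c \<in> gauss_ints \<Longrightarrow> gdvd a (a * c)"
  unfolding gdvd_def by blast

lemma gdvd_closed: "gdvd a b \<Longrightarrow> a \<in> gauss_ints \<Longrightarrow> b \<in> gauss_ints"
  unfolding gdvd_def by auto

lemma gdvd_imp_gauss_norm_le:
  assumes "gdvd a b" "b \<noteq> 0"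
  shows "gauss_norm a \<le> gauss_norm b"
proof -
  obtain c where c: "c \<in> gauss_ints" "b = a * c" using assms by (auto simp: gdvd_def)
  have "gauss_norm c \<ge> 1" using c assms by (intro gauss_norm_ge_1) auto
  hence "gauss_norm a * 1 \<le> gauss_norm a * gauss_norm c" by (intro mult_left_mono) auto
  thus ?thesis by (simp add: c)
qed

lemma finite_gdvd: "b \<noteq> 0 \<Longrightarrow> finite {a \<in> gauss_ints. gdvd a b}"
  using gdvd_imp_gauss_norm_le
  by (intro finite_subset[OF _ finite_gauss_ints_norm_le[of "gauss_norm b"]]) auto

text \<open>
  Rounding both coordinates of \<open>a / b\<close> moves it by at most \<open>1 / \<surd>2 < 1\<close>.
\<close>

lemma gauss_division:
  assumes "a \<in> gauss_ints" "b \<in> gauss_ints" "b \<noteq> 0"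
  obtains q where "q \<in> gauss_ints" "gauss_norm (a - b * q) < gauss_norm b"
proof
  define w where "w = a / b"
  define q where "q = Complex (round (Re w)) (round (Im w))"
  show "q \<in> gauss_ints" by (simp add: q_def gauss_ints_def)
  have le: "\<bar>Re (w - q)\<bar> \<le> 1 / 2" "\<bar>Im (w - q)\<bar> \<le> 1 / 2"
    using of_int_round_abs_le[of "Re w"] of_int_round_abs_le[of "Im w"]
    by (auto simp: q_def abs_minus_commute)
  have "(Re (w - q))\<^sup>2 \<le> (1 / 2)\<^sup>2" "(Im (w - q))\<^sup>2 \<le> (1 / 2)\<^sup>2"
    using le abs_le_square_iff by fastforce+
  hence "gauss_norm (w - q) < 1"
    unfolding gauss_norm_altdef by (simp add: power2_eq_square)
  moreover have "a - b * q = b * (w - q)"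
    using assms by (simp add: w_def algebra_simps)
  moreover have "gauss_norm b > 0" using assms by simp
  ultimately show "gauss_norm (a - b * q) < gauss_norm b"
    by simp
qed

text \<open>
  A nonzero element of minimal norm generates, since division by it leaves a remainder of smaller norm.
\<close>

lemma gauss_ideal_principal:
  assumes sub: "I \<subseteq> gauss_ints" and "I \<noteq> {}"
  assumes add: "\<And>a b. a \<in> I \<Longrightarrow> b \<in> I \<Longrightarrow> a + b \<in> I"
  assumes mult: "\<And>a c. a \<in> I \<Longrightarrow> c \<in> gauss_ints \<Longrightarrow> a * c \<in> I"
  shows "\<exists>g\<in>I. I = {b. gdvd g b}"
proof (cases "I \<subseteq> {0}")
  case True
  hence "I = {0}" using assms by auto
  thus ?thesis by auto
next
  case False
  then obtain g0 where "g0 \<in> I" "g0 \<noteq> 0" by auto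
  hence "\<exists>g. (g \<in> I \<and> g \<noteq> 0) \<and> (\<forall>h. h \<in> I \<and> h \<noteq> 0 \<longrightarrow> nat \<lfloor>gauss_norm g\<rfloor> \<le> nat \<lfloor>gauss_norm h\<rfloor>)"
    by (intro ex_has_least_nat[where k = g0]) auto
  then obtain g where g: "g \<in> I" "g \<noteq> 0"
    and least: "\<And>h. h \<in> I \<Longrightarrow> h \<noteq> 0 \<Longrightarrow> nat \<lfloor>gauss_norm g\<rfloor> \<le> nat \<lfloor>gauss_norm h\<rfloor>"
    by blast
  have least': "gauss_norm g \<le> gauss_norm h" if "h \<in> I" "h \<noteq> 0" for h
    using least[OF that] gauss_norm_nat[of g] gauss_norm_nat[of h] sub g that
    by (auto simp: subset_iff)
  have "I = {b. gdvd g b}"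
  proof (intro equalityI subsetI)
    fix b assume b: "b \<in> I"
    obtain q where q: "q \<in> gauss_ints" "gauss_norm (b - g * q) < gauss_norm g"
      using gauss_division[of b g] b g sub by (auto simp: subset_iff)
    have "b - g * q = b + g * (- q)" by simp
    also have "\<dots> \<in> I" using b g q by (intro add mult) auto
    finally have "b - g * q = 0" using least' q(2) by force
    thus "b \<in> {b. gdvd g b}" using q by (simp add: gdvd_def)
  next
    fix b assume "b \<in> {b. gdvd g b}"
    thus "b \<in> I" using mult g by (auto simp: gdvd_def)
  qed
  with g show ?thesis by blast
qed

lemma bezout_gauss:
  assumes "\<alpha> \<in> gauss_ints" "\<gamma> \<in> gauss_ints"
  shows "\<exists>g. g \<in> gauss_ints \<and> gdvd g \<alpha> \<and> gdvd g \<gamma> \<and>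
           (\<exists>u\<in>gauss_ints. \<exists>v\<in>gauss_ints. g = u * \<alpha> + v * \<gamma>)"
proof -
  define I where "I = {u * \<alpha> + v * \<gamma> |u v. u \<in> gauss_ints \<and> v \<in> gauss_ints}"
  have "\<exists>g\<in>I. I = {b. gdvd g b}"
  proof (rule gauss_ideal_principal)
    show "I \<subseteq> gauss_ints" using assms by (auto simp: I_def)
    show "I \<noteq> {}" by (auto simp: I_def)
  next
    fix a b assume "a \<in> I" "b \<in> I"
    then obtain u v u' v' where *: "u \<in> gauss_ints" "v \<in> gauss_ints" "u' \<in> gauss_ints" "v' \<in> gauss_ints"
      "a = u * \<alpha> + v * \<gamma>" "b = u' * \<alpha> + v' * \<gamma>"
      by (auto simp: I_def)
    have "a + b = (u + u') * \<alpha> + (v + v') * \<gamma>" by (simp add: * algebra_simps)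
    thus "a + b \<in> I" unfolding I_def using * by blast
  next
    fix a c assume "a \<in> I" "c \<in> gauss_ints"
    then obtain u v where *: "u \<in> gauss_ints" "v \<in> gauss_ints" "c \<in> gauss_ints" "a = u * \<alpha> + v * \<gamma>"
      by (auto simp: I_def)
    have "a * c = (u * c) * \<alpha> + (v * c) * \<gamma>" by (simp add: * algebra_simps)
    thus "a * c \<in> I" unfolding I_def using * by blast
  qed
  then obtain g where g: "g \<in> I" "I = {b. gdvd g b}" by blast
  have "1 * \<alpha> + 0 * \<gamma> \<in> I" "0 * \<alpha> + 1 * \<gamma> \<in> I" unfolding I_def by blast+
  hence "gdvd g \<alpha>" "gdvd g \<gamma>" using g(2) by auto
  moreover have "g \<in> gauss_ints" using g(1) assms by (auto simp: I_def)
  ultimately show ?thesis using g(1) by (auto simp: I_def)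
qed

text \<open>
  A gcd is determined only up to units, and the value is an arbitrary choice among them; every later use depends
  on its associate class only.
\<close>

definition gauss_gcd :: "complex \<Rightarrow> complex \<Rightarrow> complex" where
  "gauss_gcd \<alpha> \<gamma> = (SOME g. g \<in> gauss_ints \<and> gdvd g \<alpha> \<and> gdvd g \<gamma> \<and>
     (\<exists>u\<in>gauss_ints. \<exists>v\<in>gauss_ints. g = u * \<alpha> + v * \<gamma>))"

definition gauss_coprime :: "complex \<Rightarrow> complex \<Rightarrow> bool" where
  "gauss_coprime \<alpha> \<gamma> \<longleftrightarrow> (\<exists>u\<in>gauss_ints. \<exists>v\<in>gauss_ints. u * \<alpha> + v * \<gamma> = 1)"

definition associates :: "complex \<Rightarrow> complex set" where
  "associates g = {h \<in> gauss_ints. gdvd g h \<and> gdvd h g}"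

lemma gauss_gcd:
  assumes "\<alpha> \<in> gauss_ints" "\<gamma> \<in> gauss_ints"
  shows "gauss_gcd \<alpha> \<gamma> \<in> gauss_ints" "gdvd (gauss_gcd \<alpha> \<gamma>) \<alpha>" "gdvd (gauss_gcd \<alpha> \<gamma>) \<gamma>"
    "\<exists>u\<in>gauss_ints. \<exists>v\<in>gauss_ints. gauss_gcd \<alpha> \<gamma> = u * \<alpha> + v * \<gamma>"
  using someI_ex[OF bezout_gauss[OF assms]] unfolding gauss_gcd_def by blast+

lemma gdvd_gauss_gcd:
  assumes "\<alpha> \<in> gauss_ints" "\<gamma> \<in> gauss_ints" "gdvd h \<alpha>" "gdvd h \<gamma>"
  shows "gdvd h (gauss_gcd \<alpha> \<gamma>)"
  using gauss_gcd(4)[OF assms(1,2)] assms(3,4) by (metis gdvd_add gdvd_mult)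

lemma gauss_gcd_nonzero:
  assumes "\<alpha> \<in> gauss_ints" "\<gamma> \<in> gauss_ints" "\<alpha> \<noteq> 0"
  shows "gauss_gcd \<alpha> \<gamma> \<noteq> 0"
  using gauss_gcd(2)[OF assms(1,2)] assms(3) by auto

lemma gauss_gcd_mult_coprime:
  assumes "g \<in> gauss_ints" "\<alpha> \<in> gauss_ints" "\<gamma> \<in> gauss_ints" "gauss_coprime \<alpha> \<gamma>"
  shows "gdvd g (gauss_gcd (g * \<alpha>) (g * \<gamma>))" "gdvd (gauss_gcd (g * \<alpha>) (g * \<gamma>)) g"
proof -
  show "gdvd g (gauss_gcd (g * \<alpha>) (g * \<gamma>))"
    using assms by (intro gdvd_gauss_gcd) auto
  obtain u v where uv: "u \<in> gauss_ints" "v \<in> gauss_ints" "u * \<alpha> + v * \<gamma> = 1"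
    using assms(4) by (auto simp: gauss_coprime_def)
  have "gdvd (gauss_gcd (g * \<alpha>) (g * \<gamma>)) (u * (g * \<alpha>) + v * (g * \<gamma>))"
    using assms uv by (intro gdvd_add gdvd_mult gauss_gcd) auto
  also have "u * (g * \<alpha>) + v * (g * \<gamma>) = g * (u * \<alpha> + v * \<gamma>)" by (simp add: algebra_simps)
  finally show "gdvd (gauss_gcd (g * \<alpha>) (g * \<gamma>)) g" using uv by simp
qed

lemma gauss_coprime_div_associate_gcd:
  assumes "\<alpha> \<in> gauss_ints" "\<gamma> \<in> gauss_ints" "\<alpha> \<noteq> 0" "g \<in> associates (gauss_gcd \<alpha> \<gamma>)"
  shows "g \<noteq> 0" "\<alpha> / g \<in> gauss_ints" "\<gamma> / g \<in> gauss_ints" "gauss_coprime (\<alpha> / g) (\<gamma> / g)"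
proof -
  have g: "gdvd (gauss_gcd \<alpha> \<gamma>) g" "gdvd g (gauss_gcd \<alpha> \<gamma>)"
    using assms(4) by (auto simp: associates_def)
  show nz: "g \<noteq> 0" using g gauss_gcd_nonzero[OF assms(1-3)] by auto
  have "gdvd g \<alpha>" "gdvd g \<gamma>" using g(2) gauss_gcd[OF assms(1,2)] gdvd_trans by blast+
  thus "\<alpha> / g \<in> gauss_ints" "\<gamma> / g \<in> gauss_ints" using nz by (auto simp: gdvd_def)
  obtain u v where uv: "u \<in> gauss_ints" "v \<in> gauss_ints" "gauss_gcd \<alpha> \<gamma> = u * \<alpha> + v * \<gamma>"
    using gauss_gcd(4)[OF assms(1,2)] by blast
  obtain e where e: "e \<in> gauss_ints" "g = gauss_gcd \<alpha> \<gamma> * e" using g(1) by (auto simp: gdvd_def)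
  have "(u * e) * (\<alpha> / g) + (v * e) * (\<gamma> / g) = (gauss_gcd \<alpha> \<gamma> * e) / g"
    using uv(3) by (simp add: algebra_simps add_divide_distrib)
  also have "\<dots> = 1" using e(2) nz by simp
  finally show "gauss_coprime (\<alpha> / g) (\<gamma> / g)"
    unfolding gauss_coprime_def using uv e by (meson gauss_ints_intros(8))
qed

text \<open>
  From \<open>a\<^sup>2 + b\<^sup>2 = 1\<close> both coordinates are in \<open>{-1, 0, 1}\<close>, and exactly one of them is nonzero.
\<close>

lemma gauss_unit_cases:
  assumes "u \<in> gauss_ints" "gauss_norm u = 1"
  shows "u \<in> {1, -1, \<i>, -\<i>}"
proof -
  obtain a b :: int where u: "u = Complex a b" using assms(1) by (auto simp: gauss_ints_Complex_iff)
  have "real_of_int (a\<^sup>2 + b\<^sup>2) = 1" using assms(2) by (simp add: u gauss_norm_altdef)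
  hence ab: "a\<^sup>2 + b\<^sup>2 = 1" by linarith
  have "\<bar>a\<bar> \<le> 1" "\<bar>b\<bar> \<le> 1"
    using ab abs_le_square_iff[of a 1] abs_le_square_iff[of b 1] zero_le_power2[of a] zero_le_power2[of b]
    by (simp_all del: zero_le_power2) 
  hence "a \<in> {-1,0,1}" "b \<in> {-1,0,1}" by auto
  thus ?thesis using ab by (auto simp: u complex_eq_iff)
qed

lemma associates_altdef:
  assumes "g \<in> gauss_ints" "g \<noteq> 0"
  shows "associates g = (\<lambda>u. g * u) ` {1, -1, \<i>, -\<i>}"
proof (intro equalityI subsetI)
  fix h assume "h \<in> associates g"
  then obtain c d where cd: "c \<in> gauss_ints" "h = g * c" "d \<in> gauss_ints" "g = h * d"
    unfolding associates_def gdvd_def by blast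
  have "g * 1 = g * (c * d)" using cd(2,4) by (metis mult.assoc mult.right_neutral)
  hence "c * d = 1" using assms by (metis mult_cancel_left)
  hence "gauss_norm c * gauss_norm d = 1" by (metis gauss_norm_1 gauss_norm_mult)
  moreover have "gauss_norm c \<ge> 1" "gauss_norm d \<ge> 1"
    using cd \<open>c * d = 1\<close> by (auto intro!: gauss_norm_ge_1)
  ultimately have "gauss_norm c = 1"
    by (smt (verit) mult_le_cancel_left1)
  thus "h \<in> (\<lambda>u. g * u) ` {1, -1, \<i>, -\<i>}"
    using gauss_unit_cases[OF cd(1)] cd(2) by blast
next
  fix h assume "h \<in> (\<lambda>u. g * u) ` {1, -1, \<i>, -\<i>}"
  then obtain u where u: "h = g * u" "u \<in> {1, -1, \<i>, -\<i>}" by (elim imageE)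
  have uG: "u \<in> gauss_ints" "cnj u \<in> gauss_ints" using u by auto
  have "u * cnj u = 1" using u(2) by auto
  hence "g = h * cnj u" unfolding u(1) by (simp add: mult.assoc)
  hence "gdvd h g" using uG(2) unfolding gdvd_def by blast
  moreover have "gdvd g h" using uG(1) unfolding gdvd_def u(1) by blast
  moreover have "h \<in> gauss_ints" using assms(1) uG(1) by (simp add: u(1))
  ultimately show "h \<in> associates g" by (simp add: associates_def)
qed

lemma card_associates:
  assumes "g \<in> gauss_ints" "g \<noteq> 0"
  shows "card (associates g) = 4"
proof -
  have "inj_on (\<lambda>u. g * u) {1, -1, \<i>, -\<i>}" using assms by (intro inj_onI) simp
  hence "card (associates g) = card {1, -1, \<i>, -\<i>}"
    unfolding associates_altdef[OF assms] by (rule card_image)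
  also have "\<dots> = 4" by (simp add: complex_eq_iff)
  finally show ?thesis .
qed

lemma finite_associates: "g \<in> gauss_ints \<Longrightarrow> g \<noteq> 0 \<Longrightarrow> finite (associates g)"
  by (simp add: associates_altdef)

definition coprime_pairs :: "real \<Rightarrow> (complex \<times> complex) set" where
  "coprime_pairs z = {(\<alpha>, \<gamma>) \<in> gdisc z \<times> gdisc z. gauss_coprime \<alpha> \<gamma>}"

lemma finite_coprime_pairs [simp]: "finite (coprime_pairs z)"
  unfolding coprime_pairs_def by (rule finite_subset[of _ "gdisc z \<times> gdisc z"]) auto

text \<open>
  The pairs of norm at most \<open>z\<close> with a given gcd \<open>g\<close> are \<open>(g \<alpha>, g \<gamma>)\<close> with
  \<open>(\<alpha>, \<gamma>)\<close> coprime of norm at most \<open>z / N(g)\<close>. Letting \<open>g\<close> run over elements rather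
  than ideals counts every pair four times, once for each choice of the gcd among its associates.
\<close>

lemma sum_pairs_by_gcd:
  fixes h :: "complex \<Rightarrow> complex \<Rightarrow> real"
  shows "(\<Sum>(\<alpha>,\<gamma>)\<in>gdisc z \<times> gdisc z. h \<alpha> \<gamma>) =
         (\<Sum>g\<in>gdisc z. \<Sum>(\<alpha>,\<gamma>)\<in>coprime_pairs (z / gauss_norm g). h (g * \<alpha>) (g * \<gamma>)) / 4"
proof -
  define A where "A = Sigma (gdisc z \<times> gdisc z) (\<lambda>(\<alpha>,\<gamma>). associates (gauss_gcd \<alpha> \<gamma>))"
  define B where "B = Sigma (gdisc z) (\<lambda>g. coprime_pairs (z / gauss_norm g))"
  have card: "card (associates (gauss_gcd \<alpha> \<gamma>)) = 4" if "\<alpha> \<in> gdisc z" "\<gamma> \<in> gdisc z" for \<alpha> \<gamma>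
    using that gdiscD(1,2) by (intro card_associates gauss_gcd gauss_gcd_nonzero) blast+
  have fin: "finite (associates (gauss_gcd \<alpha> \<gamma>))" if "\<alpha> \<in> gdisc z" "\<gamma> \<in> gdisc z" for \<alpha> \<gamma>
    using card[OF that] by (metis card.infinite zero_neq_numeral)
  have "4 * (\<Sum>(\<alpha>,\<gamma>)\<in>gdisc z \<times> gdisc z. h \<alpha> \<gamma>) =
        (\<Sum>p\<in>gdisc z \<times> gdisc z. \<Sum>g\<in>associates (gauss_gcd (fst p) (snd p)). h (fst p) (snd p))"
    unfolding sum_distrib_left by (intro sum.cong) (auto simp: card)
  also have "\<dots> = (\<Sum>(p,g)\<in>A. h (fst p) (snd p))"
    unfolding A_def by (subst sum.Sigma) (auto simp: fin case_prod_unfold)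
  also have "\<dots> = (\<Sum>(g,p)\<in>B. h (g * fst p) (g * snd p))"
  proof (rule sum.reindex_bij_witness[where
        i = "\<lambda>(g,p). ((g * fst p, g * snd p), g)" and
        j = "\<lambda>(p,g). (g, (fst p / g, snd p / g))"])
    fix a assume "a \<in> A"
    then obtain \<alpha> \<gamma> g where a: "a = ((\<alpha>,\<gamma>),g)" "\<alpha> \<in> gdisc z" "\<gamma> \<in> gdisc z"
      "g \<in> associates (gauss_gcd \<alpha> \<gamma>)" by (auto simp: A_def)
    note g = gauss_coprime_div_associate_gcd[OF gdiscD(1)[OF a(2)] gdiscD(1)[OF a(3)] gdiscD(2)[OF a(2)] a(4)]
    show "(case case a of (p, g) \<Rightarrow> (g, fst p / g, snd p / g) of
             (g, p) \<Rightarrow> ((g * fst p, g * snd p), g)) = a"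
      using g by (simp add: a)
    show "(case case a of (p, g) \<Rightarrow> (g, fst p / g, snd p / g) of
             (g, p) \<Rightarrow> h (g * fst p) (g * snd p)) = (case a of (p, g) \<Rightarrow> h (fst p) (snd p))"
      using g by (simp add: a)
    have gG: "g \<in> gauss_ints" using a(4) by (simp add: associates_def)
    have "gauss_norm g \<le> gauss_norm \<alpha>"
      by (rule gdvd_imp_gauss_norm_le) (use g gdiscD(2)[OF a(2)] in \<open>auto simp: gdvd_def intro!: bexI[of _ "\<alpha> / g"]\<close>)
    moreover have "gauss_norm g > 0" using g by simp
    ultimately show "(case a of (p, g) \<Rightarrow> (g, fst p / g, snd p / g)) \<in> B"
      using g gG gdiscD(2,3)[OF a(2)] gdiscD(2,3)[OF a(3)]
      by (auto simp: a(1) B_def coprime_pairs_def gdisc_def gauss_norm_divide divide_right_mono)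
  next
    fix b assume "b \<in> B"
    then obtain g \<alpha> \<gamma> where b: "b = (g,(\<alpha>,\<gamma>))" "g \<in> gdisc z" "\<alpha> \<in> gdisc (z / gauss_norm g)"
      "\<gamma> \<in> gdisc (z / gauss_norm g)" "gauss_coprime \<alpha> \<gamma>"
      by (auto simp: B_def coprime_pairs_def)
    note D = gdiscD[OF b(2)] gdiscD[OF b(3)] gdiscD[OF b(4)]
    show "(case case b of (g, p) \<Rightarrow> ((g * fst p, g * snd p), g) of
             (p, g) \<Rightarrow> (g, fst p / g, snd p / g)) = b"
      using D by (simp add: b)
    have "gauss_norm g * gauss_norm \<alpha> \<le> z" "gauss_norm g * gauss_norm \<gamma> \<le> z"
      using D by (simp_all add: field_simps)
    thus "(case b of (g, p) \<Rightarrow> ((g * fst p, g * snd p), g)) \<in> A"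
      using D gauss_gcd_mult_coprime[OF D(1) _ _ b(5)]
      by (auto simp: b(1) A_def associates_def gdisc_def)
  qed
  also have "\<dots> = (\<Sum>g\<in>gdisc z. \<Sum>(\<alpha>,\<gamma>)\<in>coprime_pairs (z / gauss_norm g). h (g * \<alpha>) (g * \<gamma>))"
    unfolding B_def by (subst sum.Sigma) (auto simp: case_prod_unfold)
  finally show ?thesis by simp
qed

section \<open>Ideals and their generators\<close>

lemma gauss_ring_simps [simp]:
  "carrier gauss_ring = gauss_ints" "mult gauss_ring = (*)" "one gauss_ring = 1"
  "zero gauss_ring = 0" "add gauss_ring = (+)"
  by (simp_all add: gauss_ring_def)

lemma cring_gauss_ring: "cring gauss_ring"
proof (rule cringI)
  show "abelian_group gauss_ring"
    by (rule abelian_groupI) (auto simp: intro!: bexI[of _ "- _"])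
  show "comm_monoid gauss_ring"
    by (rule comm_monoidI) auto
qed (auto simp: algebra_simps)

lemma PIdl_gauss_ring: "PIdl\<^bsub>gauss_ring\<^esub> a = {b. gdvd a b}"
  by (auto simp: cgenideal_def gdvd_def mult.commute)

lemma ideal_PIdl_gauss_ring: "a \<in> gauss_ints \<Longrightarrow> ideal (PIdl\<^bsub>gauss_ring\<^esub> a) gauss_ring"
  using cring.cgenideal_ideal[OF cring_gauss_ring, of a] by simp

lemma PIdl_gauss_ring_eq_iff:
  "PIdl\<^bsub>gauss_ring\<^esub> a = PIdl\<^bsub>gauss_ring\<^esub> b \<longleftrightarrow> gdvd a b \<and> gdvd b a"
  unfolding PIdl_gauss_ring using gdvd_trans by (auto simp: set_eq_iff)

lemma ideal_gauss_ring_principal: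
  assumes "ideal I gauss_ring"
  obtains g where "g \<in> gauss_ints" "I = PIdl\<^bsub>gauss_ring\<^esub> g"
proof -
  interpret ideal I gauss_ring by fact
  have "\<exists>g\<in>I. I = {b. gdvd g b}"
  proof (rule gauss_ideal_principal)
    show "I \<subseteq> gauss_ints" using a_subset by simp
    show "I \<noteq> {}" using additive_subgroup.zero_closed[OF is_additive_subgroup] by auto
    show "a + b \<in> I" if "a \<in> I" "b \<in> I" for a b using additive_subgroup.a_closed[OF is_additive_subgroup that] by simp
    show "a * c \<in> I" if "a \<in> I" "c \<in> gauss_ints" for a c using I_r_closed[of a c] that by simp
  qed
  then obtain g where "g \<in> I" "I = {b. gdvd g b}" by blast
  moreover have "g \<in> gauss_ints" using \<open>g \<in> I\<close> a_subset by auto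
  ultimately show ?thesis using that by (simp add: PIdl_gauss_ring)
qed

lemma ideal_dvd_PIdl_iff:
  assumes "a \<in> gauss_ints" "\<nu> \<in> gauss_ints"
  shows "ideal_dvd (PIdl\<^bsub>gauss_ring\<^esub> a) (PIdl\<^bsub>gauss_ring\<^esub> \<nu>) \<longleftrightarrow> gdvd a \<nu>"
proof
  interpret cring gauss_ring by (rule cring_gauss_ring)
  assume "ideal_dvd (PIdl\<^bsub>gauss_ring\<^esub> a) (PIdl\<^bsub>gauss_ring\<^esub> \<nu>)"
  then obtain L where L: "ideal L gauss_ring"
    "PIdl\<^bsub>gauss_ring\<^esub> \<nu> = ideal_prod gauss_ring (PIdl\<^bsub>gauss_ring\<^esub> a) L"
    by (auto simp: ideal_dvd_def)
  have "PIdl\<^bsub>gauss_ring\<^esub> \<nu> \<subseteq> PIdl\<^bsub>gauss_ring\<^esub> a"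
    using ideal_prod_inter[OF ideal_PIdl_gauss_ring[OF assms(1)] L(1)] L(2) by simp
  thus "gdvd a \<nu>" using gdvd_refl[of \<nu>] unfolding PIdl_gauss_ring by blast
next
  assume "gdvd a \<nu>"
  then obtain c where c: "c \<in> gauss_ints" "\<nu> = a * c" by (auto simp: gdvd_def)
  have "PIdl\<^bsub>gauss_ring\<^esub> \<nu> = ideal_prod gauss_ring (PIdl\<^bsub>gauss_ring\<^esub> a) (PIdl\<^bsub>gauss_ring\<^esub> c)"
  proof (intro equalityI subsetI)
    fix b assume "b \<in> PIdl\<^bsub>gauss_ring\<^esub> \<nu>"
    then obtain d where d: "d \<in> gauss_ints" "b = a * (c * d)"
      by (auto simp: PIdl_gauss_ring gdvd_def c mult.assoc)
    have "a \<otimes>\<^bsub>gauss_ring\<^esub> (c * d) \<in>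
        ideal_prod gauss_ring (PIdl\<^bsub>gauss_ring\<^esub> a) (PIdl\<^bsub>gauss_ring\<^esub> c)"
      using d by (intro ideal_prod.prod) (auto simp: PIdl_gauss_ring)
    thus "b \<in> ideal_prod gauss_ring (PIdl\<^bsub>gauss_ring\<^esub> a) (PIdl\<^bsub>gauss_ring\<^esub> c)"
      using d by simp
  next
    fix b assume "b \<in> ideal_prod gauss_ring (PIdl\<^bsub>gauss_ring\<^esub> a) (PIdl\<^bsub>gauss_ring\<^esub> c)"
    hence "gdvd \<nu> b"
    proof induction
      case (prod i j)
      then obtain i' j' where "i' \<in> gauss_ints" "i = a * i'" "j' \<in> gauss_ints" "j = c * j'"
        by (auto simp: PIdl_gauss_ring gdvd_def)
      thus ?case unfolding gdvd_def c by (intro bexI[of _ "i' * j'"]) auto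
    qed (auto intro: gdvd_add)
    thus "b \<in> PIdl\<^bsub>gauss_ring\<^esub> \<nu>" by (simp add: PIdl_gauss_ring)
  qed
  thus "ideal_dvd (PIdl\<^bsub>gauss_ring\<^esub> a) (PIdl\<^bsub>gauss_ring\<^esub> \<nu>)"
    using ideal_PIdl_gauss_ring[OF c(1)] unfolding ideal_dvd_def by blast
qed

lemma ideal_divisors_eq_image:
  assumes "\<nu> \<in> gauss_ints"
  shows "ideal_divisors \<nu> = (\<lambda>g. PIdl\<^bsub>gauss_ring\<^esub> g) ` {g \<in> gauss_ints. gdvd g \<nu>}"
proof (intro equalityI subsetI)
  fix I assume I: "I \<in> ideal_divisors \<nu>"
  then obtain g where "g \<in> gauss_ints" "I = PIdl\<^bsub>gauss_ring\<^esub> g"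
    using ideal_gauss_ring_principal unfolding ideal_divisors_def by blast
  thus "I \<in> (\<lambda>g. PIdl\<^bsub>gauss_ring\<^esub> g) ` {g \<in> gauss_ints. gdvd g \<nu>}"
    using I ideal_dvd_PIdl_iff[OF _ assms] by (auto simp: ideal_divisors_def)
qed (auto simp: ideal_divisors_def ideal_PIdl_gauss_ring ideal_dvd_PIdl_iff assms)

text \<open>
  The generators of a nonzero ideal form a class of four associates.
\<close>

lemma sum_generators_eq_sum_ideals:
  fixes F :: "complex set \<Rightarrow> real"
  assumes "finite S" "S \<subseteq> gauss_ints - {0}" "\<And>g h. g \<in> S \<Longrightarrow> h \<in> associates g \<Longrightarrow> h \<in> S"
  shows "(\<Sum>g\<in>S. F (PIdl\<^bsub>gauss_ring\<^esub> g)) = 4 * (\<Sum>I\<in>(\<lambda>g. PIdl\<^bsub>gauss_ring\<^esub> g) ` S. F I)"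
proof -
  have "(\<Sum>g\<in>S. F (PIdl\<^bsub>gauss_ring\<^esub> g)) = (\<Sum>I\<in>(\<lambda>g. PIdl\<^bsub>gauss_ring\<^esub> g) ` S.
          \<Sum>g\<in>{g \<in> S. PIdl\<^bsub>gauss_ring\<^esub> g = I}. F (PIdl\<^bsub>gauss_ring\<^esub> g))"
    by (rule sum.image_gen) fact
  also have "\<dots> = (\<Sum>I\<in>(\<lambda>g. PIdl\<^bsub>gauss_ring\<^esub> g) ` S. 4 * F I)"
  proof (intro sum.cong refl)
    fix I assume "I \<in> (\<lambda>g. PIdl\<^bsub>gauss_ring\<^esub> g) ` S"
    then obtain g where g: "g \<in> S" "I = PIdl\<^bsub>gauss_ring\<^esub> g" by auto
    have "{h \<in> S. PIdl\<^bsub>gauss_ring\<^esub> h = I} = associates g"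
      using assms(2) assms(3)[OF g(1)] by (auto simp: g(2) PIdl_gauss_ring_eq_iff associates_def)
    hence "card {h \<in> S. PIdl\<^bsub>gauss_ring\<^esub> h = I} = 4"
      using card_associates[of g] g assms(2) by auto
    thus "(\<Sum>h\<in>{h \<in> S. PIdl\<^bsub>gauss_ring\<^esub> h = I}. F (PIdl\<^bsub>gauss_ring\<^esub> h)) = 4 * F I" by simp
  qed
  finally show ?thesis by (simp add: sum_distrib_left)
qed

text \<open>
  As in the finite case, but here the sum over generators has to be rearranged into blocks, one for each
  ideal, which summability permits.
\<close>

lemma infsum_generators_eq_infsum_ideals:
  fixes F :: "complex set \<Rightarrow> real"
  assumes "(\<lambda>g. F (PIdl\<^bsub>gauss_ring\<^esub> g)) summable_on (gauss_ints - {0})"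
  shows "(\<Sum>\<^sub>\<infinity>g\<in>gauss_ints - {0}. F (PIdl\<^bsub>gauss_ring\<^esub> g)) =
           4 * (\<Sum>\<^sub>\<infinity>I\<in>{I. ideal I gauss_ring \<and> I \<noteq> {0}}. F I)"
proof -
  define J where "J = {I. ideal I gauss_ring \<and> I \<noteq> {0}}"
  define gen where "gen = (\<lambda>I. {g \<in> gauss_ints - {0}. PIdl\<^bsub>gauss_ring\<^esub> g = I})"
  have J0: "PIdl\<^bsub>gauss_ring\<^esub> g = {0} \<longleftrightarrow> g = 0" for g
  proof
    assume "PIdl\<^bsub>gauss_ring\<^esub> g = {0}"
    moreover have "g \<in> PIdl\<^bsub>gauss_ring\<^esub> g" by (simp add: PIdl_gauss_ring)
    ultimately show "g = 0" by blast
  qed (simp add: PIdl_gauss_ring)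
  have bij: "bij_betw snd (Sigma J gen) (gauss_ints - {0})"
    unfolding bij_betw_def
  proof (intro conjI)
    show "inj_on snd (Sigma J gen)" unfolding gen_def inj_on_def by fastforce
    have "g \<in> snd ` Sigma J gen" if "g \<in> gauss_ints - {0}" for g
    proof (rule image_eqI)
      have "PIdl\<^bsub>gauss_ring\<^esub> g \<in> J"
        using that J0[of g] ideal_PIdl_gauss_ring[of g] by (simp add: J_def)
      thus "(PIdl\<^bsub>gauss_ring\<^esub> g, g) \<in> Sigma J gen" using that by (simp add: gen_def)
    qed simp
    moreover have "snd ` Sigma J gen \<subseteq> gauss_ints - {0}" unfolding gen_def by fastforce
    ultimately show "snd ` Sigma J gen = gauss_ints - {0}" by blast
  qed
  have eq: "F (PIdl\<^bsub>gauss_ring\<^esub> (snd p)) = (case p of (I, g) \<Rightarrow> F I)" if "p \<in> Sigma J gen" for p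
    using that by (auto simp: gen_def)
  have "(\<Sum>\<^sub>\<infinity>g\<in>gauss_ints - {0}. F (PIdl\<^bsub>gauss_ring\<^esub> g)) = (\<Sum>\<^sub>\<infinity>p\<in>Sigma J gen. F (PIdl\<^bsub>gauss_ring\<^esub> (snd p)))"
    using infsum_reindex_bij_betw[OF bij, of "\<lambda>g. F (PIdl\<^bsub>gauss_ring\<^esub> g)"] by simp
  also have "\<dots> = (\<Sum>\<^sub>\<infinity>(I,g)\<in>Sigma J gen. F I)"
    using eq by (rule infsum_cong)
  also have "\<dots> = (\<Sum>\<^sub>\<infinity>I\<in>J. \<Sum>\<^sub>\<infinity>g\<in>gen I. F I)"
  proof (rule infsum_Sigma'_banach[symmetric])
    have "(\<lambda>p. F (PIdl\<^bsub>gauss_ring\<^esub> (snd p))) summable_on Sigma J gen"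
      using assms summable_on_reindex_bij_betw[OF bij, of "\<lambda>g. F (PIdl\<^bsub>gauss_ring\<^esub> g)"] by simp
    thus "(\<lambda>(I, g). F I) summable_on Sigma J gen"
      using eq by (subst summable_on_cong[of _ _ "\<lambda>p. F (PIdl\<^bsub>gauss_ring\<^esub> (snd p))"]) auto
  qed
  also have "\<dots> = (\<Sum>\<^sub>\<infinity>I\<in>J. 4 * F I)"
  proof (rule infsum_cong)
    fix I assume "I \<in> J"
    then obtain g where g: "g \<in> gauss_ints" "I = PIdl\<^bsub>gauss_ring\<^esub> g" "I \<noteq> {0}"
      using ideal_gauss_ring_principal unfolding J_def by blast
    have "g \<noteq> 0" using g by (auto simp: PIdl_gauss_ring)
    have "gen I = associates g"
      using g \<open>g \<noteq> 0\<close> by (auto simp: gen_def PIdl_gauss_ring_eq_iff associates_def)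
    thus "(\<Sum>\<^sub>\<infinity>g\<in>gen I. F I) = 4 * F I"
      using card_associates[OF g(1) \<open>g \<noteq> 0\<close>] finite_associates[OF g(1) \<open>g \<noteq> 0\<close>] by simp
  qed
  also have "\<dots> = 4 * (\<Sum>\<^sub>\<infinity>I\<in>J. F I)" by (rule infsum_cmult_right') 
  finally show ?thesis unfolding J_def .
qed

lemma tau_eq_card_gdvd:
  assumes "\<nu> \<in> gauss_ints" "\<nu> \<noteq> 0"
  shows "real (card {g \<in> gauss_ints. gdvd g \<nu>}) = 4 * real (tau \<nu>)"
proof -
  have "(\<Sum>g\<in>{g \<in> gauss_ints. gdvd g \<nu>}. 1::real) = 4 * (\<Sum>I\<in>ideal_divisors \<nu>. 1)"
    unfolding ideal_divisors_eq_image[OF assms(1)]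
    using assms by (intro sum_generators_eq_sum_ideals finite_gdvd)
      (auto simp: associates_def intro: gdvd_trans)
  thus ?thesis by (simp add: tau_def)
qed

lemma carrier_Quot_PIdl:
  assumes "d \<in> gauss_ints"
  shows "carrier (gauss_ring Quot PIdl\<^bsub>gauss_ring\<^esub> d) =
           (\<lambda>r. {\<nu> \<in> gauss_ints. gdvd d (\<nu> - r)}) ` gauss_ints"
proof -
  have "PIdl\<^bsub>gauss_ring\<^esub> d +>\<^bsub>gauss_ring\<^esub> r = {\<nu> \<in> gauss_ints. gdvd d (\<nu> - r)}" if "r \<in> gauss_ints" for r
  proof -
    have "PIdl\<^bsub>gauss_ring\<^esub> d +>\<^bsub>gauss_ring\<^esub> r = {h + r | h. gdvd d h}"
      by (auto simp: a_r_coset_def' PIdl_gauss_ring)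
    also have "\<dots> = {\<nu> \<in> gauss_ints. gdvd d (\<nu> - r)}"
    proof (intro equalityI subsetI)
      fix \<nu> assume "\<nu> \<in> {\<nu> \<in> gauss_ints. gdvd d (\<nu> - r)}"
      hence "\<nu> = (\<nu> - r) + r \<and> gdvd d (\<nu> - r)" by simp
      thus "\<nu> \<in> {h + r | h. gdvd d h}" by blast
    qed (use that assms gdvd_closed in auto)
    finally show ?thesis .
  qed
  thus ?thesis by (auto simp: FactRing_def A_RCOSETS_def')
qed

text \<open>
  The index is found by counting lattice points. The disc of radius \<open>t\<close> contains
  \<open>\<pi> t\<^sup>2 + O(t)\<close> Gaussian integers in total and \<open>\<pi> t\<^sup>2 / N(d) + O(t)\<close> in each residue class
  modulo \<open>d\<close>. Letting \<open>t\<close> grow, the number of classes can only be \<open>N(d)\<close>.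
\<close>

lemma ideal_norm_PIdl:
  assumes "d \<in> gauss_ints" "d \<noteq> 0"
  shows "real (ideal_norm (PIdl\<^bsub>gauss_ring\<^esub> d)) = gauss_norm d"
proof -
  define cls where "cls = (\<lambda>r. {\<nu> \<in> gauss_ints. gdvd d (\<nu> - r)})"
  define Q where "Q = cls ` gauss_ints"
  have cls_eq: "cls r = cls s" if "gdvd d (r - s)" for r s
  proof -
    have "gdvd d (\<nu> - r) \<longleftrightarrow> gdvd d (\<nu> - s)" for \<nu>
      using gdvd_add[of d "\<nu> - r" "r - s"] gdvd_diff[of d "\<nu> - s" "r - s"] that by auto
    thus ?thesis by (simp add: cls_def)
  qed
  have self: "r \<in> cls r" if "r \<in> gauss_ints" for r using that by (simp add: cls_def)
  \<comment> \<open>By division with remainder, every class has a representative of norm below \<open>N(d)\<close>.\<close>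
  have finQ: "finite Q"
  proof -
    have "Q \<subseteq> cls ` {r \<in> gauss_ints. gauss_norm r \<le> gauss_norm d}"
    proof
      fix C assume "C \<in> Q"
      then obtain r where r: "r \<in> gauss_ints" "C = cls r" by (auto simp: Q_def)
      obtain q where q: "q \<in> gauss_ints" "gauss_norm (r - d * q) < gauss_norm d"
        using gauss_division[OF r(1) assms] by blast
      have "C = cls (r - d * q)" unfolding r(2) using q by (intro cls_eq) simp
      thus "C \<in> cls ` {r \<in> gauss_ints. gauss_norm r \<le> gauss_norm d}"
        using q r assms by (intro image_eqI[of _ _ "r - d * q"]) auto
    qed
    thus ?thesis using finite_gauss_ints_norm_le[of "gauss_norm d"] finite_subset by blast
  qed
  define k where "k = real (card Q)"
  define n where "n = gauss_norm d"
  have n: "n \<ge> 1" "n > 0" using gauss_norm_ge_1[OF assms] by (auto simp: n_def)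
  have k0: "k \<ge> 0" by (simp add: k_def)
  have bound: "pi * t\<^sup>2 * \<bar>1 - k / n\<bar> \<le> 8 * pi * (1 + k) * t" if t: "t \<ge> 1" for t :: real
  proof -
    define x where "x = t\<^sup>2"
    have x: "x \<ge> 1" "sqrt x = t" using t by (auto simp: x_def)
    have "{\<nu> \<in> gauss_ints. gauss_norm \<nu> \<le> x} = (\<Union>C\<in>Q. C \<inter> {\<nu>. gauss_norm \<nu> \<le> x})"
      using self by (auto simp: Q_def cls_def)
    also have "card \<dots> = (\<Sum>C\<in>Q. card (C \<inter> {\<nu>. gauss_norm \<nu> \<le> x}))"
    proof (rule card_UN_disjoint)
      show "\<forall>C\<in>Q. finite (C \<inter> {\<nu>. gauss_norm \<nu> \<le> x})"
        by (intro ballI finite_subset[OF _ finite_gauss_ints_norm_le[of x]]) (auto simp: Q_def cls_def)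
      have "C = C'" if "C \<in> Q" "C' \<in> Q" "\<nu> \<in> C" "\<nu> \<in> C'" for C C' \<nu>
      proof -
        from that(1,2) obtain r s where rs: "C = cls r" "C' = cls s" by (auto simp: Q_def)
        have "gdvd d (\<nu> - r)" "gdvd d (\<nu> - s)"
          using that(3,4) by (auto simp: rs cls_def)
        hence "cls \<nu> = cls r" "cls \<nu> = cls s" using cls_eq by blast+
        thus ?thesis by (simp add: rs)
      qed
      thus "\<forall>C\<in>Q. \<forall>C'\<in>Q. C \<noteq> C' \<longrightarrow>
              (C \<inter> {\<nu>. gauss_norm \<nu> \<le> x}) \<inter> (C' \<inter> {\<nu>. gauss_norm \<nu> \<le> x}) = {}"
        by blast
    qed (rule finQ)
    finally have "real (card {\<nu> \<in> gauss_ints. gauss_norm \<nu> \<le> x}) - k * (pi * x / n) =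
        (\<Sum>C\<in>Q. real (card (C \<inter> {\<nu>. gauss_norm \<nu> \<le> x})) - pi * x / n)"
      by (simp add: sum_subtractf k_def)
    also have "\<bar>\<dots>\<bar> \<le> (\<Sum>C\<in>Q. \<bar>real (card (C \<inter> {\<nu>. gauss_norm \<nu> \<le> x})) - pi * x / n\<bar>)"
      by (rule sum_abs)
    also have "\<dots> \<le> (\<Sum>C\<in>Q. 4 * pi * (sqrt (x / n) + 1))"
    proof (intro sum_mono)
      fix C assume "C \<in> Q"
      then obtain r where r: "r \<in> gauss_ints" "C = cls r" by (auto simp: Q_def)
      have "C \<inter> {\<nu>. gauss_norm \<nu> \<le> x} = {\<nu> \<in> gauss_ints. gdvd d (\<nu> - r) \<and> gauss_norm \<nu> \<le> x}"
        by (auto simp: r cls_def)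
      thus "\<bar>real (card (C \<inter> {\<nu>. gauss_norm \<nu> \<le> x})) - pi * x / n\<bar> \<le> 4 * pi * (sqrt (x / n) + 1)"
        using card_residue_class[OF assms r(1), of x] x by (simp add: n_def)
    qed
    also have "\<dots> = k * (4 * pi * (sqrt (x / n) + 1))" by (simp add: k_def)
    also have "\<dots> \<le> k * (4 * pi * (2 * t))"
    proof -
      have "x / n \<le> x" using n x by (simp add: divide_le_eq mult_le_cancel_left1)
      hence "sqrt (x / n) \<le> t" using x(2) real_sqrt_le_mono by metis
      thus ?thesis using t k0 by (intro mult_left_mono) auto
    qed
    finally have 1: "\<bar>real (card {\<nu> \<in> gauss_ints. gauss_norm \<nu> \<le> x}) - k * (pi * x / n)\<bar> \<le> 8 * pi * k * t"
      by (simp add: algebra_simps)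
    have "\<bar>real (card {\<nu> \<in> gauss_ints. gauss_norm \<nu> \<le> x}) - pi * x\<bar> \<le> 4 * pi * (t + 1)"
      using card_residue_class[of 1 0 x] x by (simp add: gdvd_def)
    also have "\<dots> \<le> 4 * pi * (2 * t)" using t by (intro mult_left_mono) auto
    finally have "\<bar>pi * x - k * (pi * x / n)\<bar> \<le> 8 * pi * k * t + 4 * pi * (2 * t)"
      using 1 by linarith
    also have "pi * x - k * (pi * x / n) = pi * x * (1 - k / n)" by (simp add: algebra_simps)
    also have "\<bar>\<dots>\<bar> = pi * x * \<bar>1 - k / n\<bar>" using x by (simp add: abs_mult)
    finally show ?thesis by (simp add: x_def algebra_simps)
  qed
  have "k = n"
  proof (rule ccontr)
    assume "k \<noteq> n"
    hence pos: "\<bar>1 - k / n\<bar> > 0" using n by (simp add: field_simps)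
    \<comment> \<open>A radius at which the quadratic left-hand side of the bound exceeds the linear right-hand side.\<close>
    define t where "t = 1 + 8 * (1 + k) / \<bar>1 - k / n\<bar>"
    have t: "t \<ge> 1" using pos k0 by (simp add: t_def)
    have "pi * t * (t * \<bar>1 - k / n\<bar>) \<le> pi * t * (8 * (1 + k))"
      using bound[OF t] by (simp add: power2_eq_square algebra_simps)
    hence "t * \<bar>1 - k / n\<bar> \<le> 8 * (1 + k)"
      using t by (subst (asm) mult_le_cancel_left_pos) auto
    moreover have "t * \<bar>1 - k / n\<bar> = \<bar>1 - k / n\<bar> + 8 * (1 + k)"
      unfolding t_def distrib_right using pos by simp
    ultimately show False using pos by linarith
  qed
  thus ?thesis unfolding ideal_norm_def carrier_Quot_PIdl[OF assms(1)] k_def n_def Q_def cls_def .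
qed

lemma summable_recip_norm_sq:
  "(\<lambda>g. 1 / (gauss_norm g)\<^sup>2) summable_on (gauss_ints - {0})"
proof (rule summable_on_comparison_test[OF summable_log_over_norm_sq])
  fix g assume "g \<in> gauss_ints - {0}"
  hence "ln (gauss_norm g) \<ge> 0" using gauss_norm_ge_1[of g] by auto
  thus "1 / (gauss_norm g)\<^sup>2 \<le> (ln (gauss_norm g) + 1) / (gauss_norm g)\<^sup>2"
    by (intro divide_right_mono) auto
qed auto

lemma infsum_recip_norm_sq: "(\<Sum>\<^sub>\<infinity>g\<in>gauss_ints - {0}. 1 / (gauss_norm g)\<^sup>2) = 4 * zeta_K (2::real)"
proof -
  have eq: "real (ideal_norm (PIdl\<^bsub>gauss_ring\<^esub> g)) powr (- 2) = 1 / (gauss_norm g)\<^sup>2"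
    if "g \<in> gauss_ints - {0}" for g
    using that by (simp add: ideal_norm_PIdl powr_minus_divide)
  have "(\<Sum>\<^sub>\<infinity>g\<in>gauss_ints - {0}. 1 / (gauss_norm g)\<^sup>2) =
        (\<Sum>\<^sub>\<infinity>g\<in>gauss_ints - {0}. real (ideal_norm (PIdl\<^bsub>gauss_ring\<^esub> g)) powr (- 2))"
    using eq by (intro infsum_cong) simp
  also have "\<dots> = 4 * (\<Sum>\<^sub>\<infinity>I\<in>{I. ideal I gauss_ring \<and> I \<noteq> {0}}. real (ideal_norm I) powr (- 2))"
  proof (rule infsum_generators_eq_infsum_ideals)
    show "(\<lambda>g. real (ideal_norm (PIdl\<^bsub>gauss_ring\<^esub> g)) powr (- 2)) summable_on (gauss_ints - {0})"
      using summable_recip_norm_sq eq by (subst summable_on_cong) auto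
  qed
  finally show ?thesis by (simp add: zeta_K_def)
qed

lemma sum_gdvd_recip_norm:
  assumes "\<kappa> \<in> gauss_ints" "\<kappa> \<noteq> 0"
  shows "(\<Sum>g\<in>{g \<in> gauss_ints. gdvd g \<kappa>}. 1 / gauss_norm g) = 4 * sigma_minus_one \<kappa>"
proof -
  have "(\<Sum>g\<in>{g \<in> gauss_ints. gdvd g \<kappa>}. 1 / gauss_norm g) =
        (\<Sum>g\<in>{g \<in> gauss_ints. gdvd g \<kappa>}. 1 / real (ideal_norm (PIdl\<^bsub>gauss_ring\<^esub> g)))"
    using assms by (intro sum.cong refl) (subst ideal_norm_PIdl, auto)
  also have "\<dots> = 4 * sigma_minus_one \<kappa>"
    unfolding sigma_minus_one_def ideal_divisors_eq_image[OF assms(1)]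
    using assms by (intro sum_generators_eq_sum_ideals finite_gdvd)
      (auto simp: associates_def intro: gdvd_trans)
  finally show ?thesis .
qed

section \<open>Pairs weighted by a function of their gcd\<close>

definition coprime_sum :: "real \<Rightarrow> real" where
  "coprime_sum z = (\<Sum>(\<alpha>,\<gamma>)\<in>coprime_pairs z. 1 / (gauss_norm \<alpha> * gauss_norm \<gamma>))"

lemma recip_norm_sum_sq:
  "(recip_norm_sum z)\<^sup>2 = (\<Sum>(\<alpha>,\<gamma>)\<in>gdisc z \<times> gdisc z. 1 / (gauss_norm \<alpha> * gauss_norm \<gamma>))"
  by (simp add: recip_norm_sum_def power2_eq_square sum_product sum.cartesian_product)

text \<open>
  The coprime sum varies slowly: a pair counted in \<open>C(z)\<close> but not in \<open>C(z / t)\<close> has an entry of norm between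
  \<open>z / t\<close> and \<open>z\<close>. Dropping coprimality, the sum over such pairs is a difference of squares, and
  factors into \<open>O(log z + 1)\<close> and \<open>O(log t + 1)\<close>.
\<close>

lemma coprime_sum_diff:
  obtains K where "K > 0"
    "\<And>z t. z \<ge> 1 \<Longrightarrow> t \<ge> 1 \<Longrightarrow> coprime_sum (z / t) \<le> coprime_sum z"
    "\<And>z t. z \<ge> 1 \<Longrightarrow> t \<ge> 1 \<Longrightarrow> coprime_sum z - coprime_sum (z / t) \<le> K * (ln z + 1) * (ln t + 1)"
proof -
  obtain K1 where K1: "K1 > 0" "\<And>z. z \<ge> 1 \<Longrightarrow> recip_norm_sum z \<le> K1 * (ln z + 1)"
    using recip_norm_sum_le by blast
  obtain K2 where K2: "K2 > 0"
    "\<And>z t. z \<ge> 1 \<Longrightarrow> t \<ge> 1 \<Longrightarrow> recip_norm_sum z - recip_norm_sum (z / t) \<le> K2 * (ln t + 1)"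
    using recip_norm_sum_diff by blast
  show ?thesis
  proof
    show "2 * K1 * K2 > 0" using K1 K2 by simp
    fix z t :: real assume z: "z \<ge> 1" and t: "t \<ge> 1"
    have zt: "z / t \<le> z" using z t by (simp add: divide_le_eq mult_le_cancel_left1)
    define D where "D = gdisc z"
    define E where "E = gdisc (z / t)"
    have ED: "E \<subseteq> D" unfolding D_def E_def using zt by (rule gdisc_mono)
    have fin: "finite D" "finite E" by (auto simp: D_def E_def)
    have sub: "coprime_pairs (z / t) \<subseteq> coprime_pairs z"
      using ED by (auto simp: coprime_pairs_def D_def E_def)
    have diff: "coprime_sum z - coprime_sum (z / t) =
        (\<Sum>(\<alpha>,\<gamma>)\<in>coprime_pairs z - coprime_pairs (z / t). 1 / (gauss_norm \<alpha> * gauss_norm \<gamma>))"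
      unfolding coprime_sum_def by (simp add: sum_diff sub)
    also have "\<dots> \<ge> 0" by (intro sum_nonneg) auto
    finally show "coprime_sum (z / t) \<le> coprime_sum z" by simp
    have "(\<Sum>(\<alpha>,\<gamma>)\<in>coprime_pairs z - coprime_pairs (z / t). 1 / (gauss_norm \<alpha> * gauss_norm \<gamma>)) \<le>
          (\<Sum>(\<alpha>,\<gamma>)\<in>D \<times> D - E \<times> E. 1 / (gauss_norm \<alpha> * gauss_norm \<gamma>))"
      using fin by (intro sum_mono2) (auto simp: coprime_pairs_def D_def E_def)
    also have "\<dots> = (recip_norm_sum z)\<^sup>2 - (recip_norm_sum (z / t))\<^sup>2"
      unfolding recip_norm_sum_sq D_def[symmetric] E_def[symmetric]
      using fin ED by (intro sum_diff) auto
    also have "\<dots> = (recip_norm_sum z + recip_norm_sum (z / t)) * (recip_norm_sum z - recip_norm_sum (z / t))"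
      by (simp add: power2_eq_square algebra_simps)
    also have "\<dots> \<le> (2 * (K1 * (ln z + 1))) * (K2 * (ln t + 1))"
    proof (intro mult_mono)
      have "recip_norm_sum (z / t) \<le> recip_norm_sum z"
        unfolding recip_norm_sum_def D_def[symmetric] E_def[symmetric]
        using fin ED by (intro sum_mono2) auto
      thus "recip_norm_sum z + recip_norm_sum (z / t) \<le> 2 * (K1 * (ln z + 1))"
        "0 \<le> recip_norm_sum z - recip_norm_sum (z / t)"
        using K1(2)[OF z] by linarith+
    qed (use K1(1) K2(2)[OF z t] z in auto)
    finally show "coprime_sum z - coprime_sum (z / t) \<le> 2 * K1 * K2 * (ln z + 1) * (ln t + 1)"
      unfolding diff by (simp add: mult_ac)
  qed
qed

text \<open>
  Grouping by the gcd turns the left-hand sum into \<open>\<Sum> f(g) N(g)\<^sup>-\<^sup>2 C(z / N(g))\<close>. Terms with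
  \<open>N(g) > z\<close> vanish, so the sum may be extended to all nonzero \<open>g\<close>. By slow variation each
  \<open>C(z / N(g))\<close> may be replaced by \<open>C(z)\<close> at a cost that the weight
  \<open>(log N(g) + 1) / N(g)\<^sup>2\<close> keeps summable.
\<close>

lemma sum_pairs_gcd_asymp:
  fixes f :: "complex \<Rightarrow> real"
  assumes nonneg: "\<And>g. f g \<ge> 0"
    and assoc: "\<And>g h. gdvd g h \<Longrightarrow> gdvd h g \<Longrightarrow> f g = f h"
    and summable: "(\<lambda>g. f g * (ln (gauss_norm g) + 1) / (gauss_norm g)\<^sup>2) summable_on (gauss_ints - {0})"
  obtains K where "K \<ge> 0" "\<And>z. z \<ge> 1 \<Longrightarrow>
    \<bar>4 * (\<Sum>(\<alpha>,\<gamma>)\<in>gdisc z \<times> gdisc z. f (gauss_gcd \<alpha> \<gamma>) / (gauss_norm \<alpha> * gauss_norm \<gamma>)) -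
     coprime_sum z * (\<Sum>\<^sub>\<infinity>g\<in>gauss_ints - {0}. f g / (gauss_norm g)\<^sup>2)\<bar> \<le> K * (ln z + 1)"
proof -
  define G where "G = gauss_ints - {0}"
  define a where "a = (\<lambda>g. f g / (gauss_norm g)\<^sup>2)"
  define b where "b = (\<lambda>g. a g * (ln (gauss_norm g) + 1))"
  obtain K where K: "K > 0"
    "\<And>z t. z \<ge> 1 \<Longrightarrow> t \<ge> 1 \<Longrightarrow> coprime_sum (z / t) \<le> coprime_sum z"
    "\<And>z t. z \<ge> 1 \<Longrightarrow> t \<ge> 1 \<Longrightarrow> coprime_sum z - coprime_sum (z / t) \<le> K * (ln z + 1) * (ln t + 1)"
    using coprime_sum_diff by blast
  have N1: "gauss_norm g \<ge> 1" if "g \<in> G" for g using that gauss_norm_ge_1 by (auto simp: G_def)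
  have a0: "a g \<ge> 0" for g using nonneg by (simp add: a_def)
  have b_summable: "b summable_on G"
    using summable by (simp add: b_def a_def G_def)
  have b0: "b g \<ge> 0" if "g \<in> G" for g
    unfolding b_def using a0[of g] N1[OF that] by (intro mult_nonneg_nonneg add_nonneg_nonneg) auto
  have ab: "a g \<le> b g" if "g \<in> G" for g
    unfolding b_def using a0[of g] N1[OF that] by (simp add: mult_le_cancel_left1)
  have a_summable: "a summable_on G"
    using b_summable by (rule summable_on_comparison_test) (use ab a0 in auto)
  have B0: "infsum b G \<ge> 0" using b0 by (rule infsum_nonneg)
  show ?thesis
  proof
    show "K * infsum b G \<ge> 0" using K(1) B0 by simp
    fix z :: real assume z: "z \<ge> 1"
    define c where "c = (\<lambda>g. coprime_sum (z / gauss_norm g))"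
    have c_le: "c g \<le> coprime_sum z" if "g \<in> G" for g
      unfolding c_def using z N1[OF that] by (rule K(2))
    have c0: "c g \<ge> 0" for g
      unfolding c_def coprime_sum_def by (intro sum_nonneg) auto
    have "4 * (\<Sum>(\<alpha>,\<gamma>)\<in>gdisc z \<times> gdisc z. f (gauss_gcd \<alpha> \<gamma>) / (gauss_norm \<alpha> * gauss_norm \<gamma>)) =
       (\<Sum>g\<in>gdisc z. \<Sum>(\<alpha>,\<gamma>)\<in>coprime_pairs (z / gauss_norm g).
          f (gauss_gcd (g * \<alpha>) (g * \<gamma>)) / (gauss_norm (g * \<alpha>) * gauss_norm (g * \<gamma>)))"
      by (subst sum_pairs_by_gcd) simp
    also have "\<dots> = (\<Sum>g\<in>gdisc z. a g * c g)"
    proof (intro sum.cong refl)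
      fix g assume g: "g \<in> gdisc z"
      show "(\<Sum>(\<alpha>,\<gamma>)\<in>coprime_pairs (z / gauss_norm g).
          f (gauss_gcd (g * \<alpha>) (g * \<gamma>)) / (gauss_norm (g * \<alpha>) * gauss_norm (g * \<gamma>))) = a g * c g"
        unfolding c_def coprime_sum_def sum_distrib_left
      proof (intro sum.cong refl, clarify)
        fix \<alpha> \<gamma> assume "(\<alpha>, \<gamma>) \<in> coprime_pairs (z / gauss_norm g)"
        hence "gauss_coprime \<alpha> \<gamma>" "\<alpha> \<in> gauss_ints" "\<gamma> \<in> gauss_ints"
          by (auto simp: coprime_pairs_def dest: gdiscD)
        hence "f (gauss_gcd (g * \<alpha>) (g * \<gamma>)) = f g"
          using gauss_gcd_mult_coprime[OF gdiscD(1)[OF g]] by (intro assoc) auto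
        thus "f (gauss_gcd (g * \<alpha>) (g * \<gamma>)) / (gauss_norm (g * \<alpha>) * gauss_norm (g * \<gamma>)) =
                a g * (1 / (gauss_norm \<alpha> * gauss_norm \<gamma>))"
          by (simp add: a_def power2_eq_square mult_ac)
      qed
    qed
    also have "\<dots> = infsum (\<lambda>g. a g * c g) (gdisc z)" by simp
    also have "\<dots> = infsum (\<lambda>g. a g * c g) G"
    proof (rule infsum_cong_neutral)
      fix g assume "g \<in> G - gdisc z"
      hence "z / gauss_norm g < 1" by (auto simp: G_def gdisc_def divide_less_eq)
      hence "coprime_pairs (z / gauss_norm g) = {}" by (auto simp: coprime_pairs_def gdisc_empty)
      thus "a g * c g = 0" by (simp add: c_def coprime_sum_def)
    qed (auto simp: G_def gdisc_def)
    finally have sum_eq: "4 * (\<Sum>(\<alpha>,\<gamma>)\<in>gdisc z \<times> gdisc z. f (gauss_gcd \<alpha> \<gamma>) / (gauss_norm \<alpha> * gauss_norm \<gamma>)) =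
        infsum (\<lambda>g. a g * c g) G" .
    have ac_summable: "(\<lambda>g. a g * c g) summable_on G"
    proof (rule summable_on_comparison_test)
      show "(\<lambda>g. a g * coprime_sum z) summable_on G" using a_summable by (rule summable_on_cmult_left)
      show "a g * c g \<le> a g * coprime_sum z" if "g \<in> G" for g
        using c_le[OF that] a0 by (intro mult_left_mono) auto
      show "0 \<le> a g * c g" for g using a0 c0 by simp
    qed
    have Kb_summable: "(\<lambda>g. K * (ln z + 1) * b g) summable_on G"
      using b_summable by (rule summable_on_cmult_right)
    have "coprime_sum z * infsum a G = infsum (\<lambda>g. coprime_sum z * a g) G"
      by (simp add: infsum_cmult_right')
    also have "\<dots> \<le> infsum (\<lambda>g. a g * c g + K * (ln z + 1) * b g) G"
    proof (rule infsum_mono)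
      show "(\<lambda>g. coprime_sum z * a g) summable_on G"
        using a_summable by (rule summable_on_cmult_right)
      show "(\<lambda>g. a g * c g + K * (ln z + 1) * b g) summable_on G"
        using ac_summable Kb_summable by (rule summable_on_add)
      fix g assume g: "g \<in> G"
      have "coprime_sum z * a g - a g * c g = a g * (coprime_sum z - c g)" by (simp add: algebra_simps)
      also have "\<dots> \<le> a g * (K * (ln z + 1) * (ln (gauss_norm g) + 1))"
        unfolding c_def using K(3)[OF z N1[OF g]] a0 by (intro mult_left_mono) auto
      also have "\<dots> = K * (ln z + 1) * b g" by (simp add: b_def mult_ac)
      finally show "coprime_sum z * a g \<le> a g * c g + K * (ln z + 1) * b g" by linarith
    qed
    also have "\<dots> = infsum (\<lambda>g. a g * c g) G + K * (ln z + 1) * infsum b G"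
      using ac_summable Kb_summable by (simp add: infsum_add infsum_cmult_right')
    finally have upper: "coprime_sum z * infsum a G - infsum (\<lambda>g. a g * c g) G \<le> K * infsum b G * (ln z + 1)"
      by (simp add: mult_ac)
    have "infsum (\<lambda>g. a g * c g) G \<le> infsum (\<lambda>g. coprime_sum z * a g) G"
      using a_summable ac_summable c_le a0
      by (intro infsum_mono summable_on_cmult_right)
         (simp_all add: mult.commute[of "coprime_sum z"] mult_left_mono)
    hence "infsum (\<lambda>g. a g * c g) G \<le> coprime_sum z * infsum a G"
      by (simp add: infsum_cmult_right')
    hence "\<bar>infsum (\<lambda>g. a g * c g) G - coprime_sum z * infsum a G\<bar> \<le> K * infsum b G * (ln z + 1)"
      using upper by linarith
    thus "\<bar>4 * (\<Sum>(\<alpha>,\<gamma>)\<in>gdisc z \<times> gdisc z. f (gauss_gcd \<alpha> \<gamma>) / (gauss_norm \<alpha> * gauss_norm \<gamma>)) -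
       coprime_sum z * (\<Sum>\<^sub>\<infinity>g\<in>gauss_ints - {0}. f g / (gauss_norm g)\<^sup>2)\<bar> \<le> K * infsum b G * (ln z + 1)"
      unfolding sum_eq by (simp add: a_def G_def)
  qed
qed

text \<open>
  The density, among all Gaussian integers, of the \<open>\<nu>\<close> with
  \<open>\<alpha> | \<nu>\<close> and \<open>\<gamma> | \<nu> + \<kappa>\<close>: the inverse norm of \<open>lcm(\<alpha>, \<gamma>)\<close> if the two
  conditions are compatible, and zero otherwise.
\<close>

definition pair_density :: "complex \<Rightarrow> complex \<Rightarrow> complex \<Rightarrow> real" where
  "pair_density \<kappa> \<alpha> \<gamma> = (if gdvd (gauss_gcd \<alpha> \<gamma>) \<kappa> then gauss_norm (gauss_gcd \<alpha> \<gamma>) else 0)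
     / (gauss_norm \<alpha> * gauss_norm \<gamma>)"

text \<open>
  The unit ideal alone contributes 1.
\<close>

lemma zeta_K_2_pos: "zeta_K (2::real) > 0"
proof -
  have "(\<Sum>g\<in>{1}. 1 / (gauss_norm g)\<^sup>2) \<le> (\<Sum>\<^sub>\<infinity>g\<in>gauss_ints - {0}. 1 / (gauss_norm g)\<^sup>2)"
    by (rule finite_sum_le_infsum[OF summable_recip_norm_sq]) auto
  thus ?thesis unfolding infsum_recip_norm_sq by simp
qed

text \<open>
  Two instances of \<open>sum_pairs_gcd_asymp\<close> are compared. The weight \<open>f(g) = N(g)\<close> for
  \<open>g | \<kappa>\<close>, and zero otherwise, shows that the sum is \<open>\<sigma>\<^sub>-\<^sub>1(\<kappa>) C(z) + O(log z + 1)\<close>. The constant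
  weight shows that \<open>\<zeta>\<^sub>K(2) C(z)\<close> is, up to the same error, the sum over all pairs, which is the
  square of \<open>\<Sum> 1 / N(\<alpha>) = \<pi> log z + O(1)\<close>. Eliminating \<open>C(z)\<close> gives the claim.
\<close>

lemma sum_pair_density_asymp:
  assumes "\<kappa> \<in> gauss_ints" "\<kappa> \<noteq> 0"
  obtains K where "K \<ge> 0" "\<And>z. z \<ge> 1 \<Longrightarrow>
    \<bar>(\<Sum>(\<alpha>,\<gamma>)\<in>gdisc z \<times> gdisc z. pair_density \<kappa> \<alpha> \<gamma>) -
      pi\<^sup>2 * sigma_minus_one \<kappa> / zeta_K (2::real) * (ln z)\<^sup>2\<bar> \<le> K * (ln z + 1)"
proof -
  define f where "f = (\<lambda>g. if gdvd g \<kappa> then gauss_norm g else 0)"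
  define M where "M = (\<lambda>z. \<Sum>(\<alpha>,\<gamma>)\<in>gdisc z \<times> gdisc z. pair_density \<kappa> \<alpha> \<gamma>)"
  define H where "H = recip_norm_sum"
  define C where "C = coprime_sum"
  define s where "s = sigma_minus_one \<kappa>"
  define Z where "Z = zeta_K (2::real)"
  have Z: "Z > 0" using zeta_K_2_pos by (simp add: Z_def)
  have s0: "s \<ge> 0" unfolding s_def sigma_minus_one_def by (intro sum_nonneg) auto
  define Dv where "Dv = {g \<in> gauss_ints. gdvd g \<kappa>}"
  have Dv: "finite Dv" "Dv \<subseteq> gauss_ints - {0}"
    unfolding Dv_def using finite_gdvd[OF assms(2)] assms by auto
  have f_out: "f g = 0" if "g \<in> gauss_ints - {0} - Dv" for g
    using that by (auto simp: f_def Dv_def)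
  obtain K1 where K1: "K1 \<ge> 0" "\<And>z. z \<ge> 1 \<Longrightarrow> \<bar>4 * M z - C z * (4 * s)\<bar> \<le> K1 * (ln z + 1)"
  proof -
    have "(\<lambda>g. f g * (ln (gauss_norm g) + 1) / (gauss_norm g)\<^sup>2) summable_on Dv"
      using Dv by simp
    hence summ: "(\<lambda>g. f g * (ln (gauss_norm g) + 1) / (gauss_norm g)\<^sup>2) summable_on (gauss_ints - {0})"
      using Dv f_out by (subst summable_on_cong_neutral[where T = Dv and S = "gauss_ints - {0}"]) auto
    have "(\<Sum>\<^sub>\<infinity>g\<in>gauss_ints - {0}. f g / (gauss_norm g)\<^sup>2) = (\<Sum>\<^sub>\<infinity>g\<in>Dv. f g / (gauss_norm g)\<^sup>2)"
      using Dv f_out by (intro infsum_cong_neutral) auto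
    also have "\<dots> = (\<Sum>g\<in>Dv. 1 / gauss_norm g)"
      unfolding infsum_finite[OF Dv(1)] by (intro sum.cong) (auto simp: f_def Dv_def power2_eq_square)
    also have "\<dots> = 4 * s" unfolding Dv_def s_def using assms by (rule sum_gdvd_recip_norm)
    finally have inf: "(\<Sum>\<^sub>\<infinity>g\<in>gauss_ints - {0}. f g / (gauss_norm g)\<^sup>2) = 4 * s" .
    have M_eq: "M z = (\<Sum>(\<alpha>,\<gamma>)\<in>gdisc z \<times> gdisc z. f (gauss_gcd \<alpha> \<gamma>) / (gauss_norm \<alpha> * gauss_norm \<gamma>))" for z
      by (simp add: M_def f_def pair_density_def)
    have fassoc: "f g = f h" if "gdvd g h" "gdvd h g" for g h
    proof (cases "h = 0")
      case False
      hence "g \<noteq> 0" using that by auto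
      with False have "gauss_norm g = gauss_norm h"
        using that by (intro antisym gdvd_imp_gauss_norm_le)
      moreover have "gdvd g \<kappa> \<longleftrightarrow> gdvd h \<kappa>" using that gdvd_trans by blast
      ultimately show ?thesis by (simp add: f_def)
    qed (use that in simp)
    show ?thesis
      using sum_pairs_gcd_asymp[of f thesis, OF _ fassoc summ] that unfolding inf M_eq C_def
      by (auto simp: f_def)
  qed
  obtain K2 where K2: "K2 \<ge> 0" "\<And>z. z \<ge> 1 \<Longrightarrow> \<bar>4 * (H z)\<^sup>2 - C z * (4 * Z)\<bar> \<le> K2 * (ln z + 1)"
    using sum_pairs_gcd_asymp[of "\<lambda>_. 1" thesis] summable_log_over_norm_sq that
    unfolding H_def C_def Z_def recip_norm_sum_sq infsum_recip_norm_sq by auto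
  obtain K3 where K3: "K3 \<ge> 0" "\<And>z. z \<ge> 1 \<Longrightarrow> \<bar>H z - pi * ln z\<bar> \<le> K3"
    unfolding H_def using recip_norm_sum_asymp by blast
  define K4 where "K4 = K3 * (2 * pi + K3)"
  define K where "K = K1 / 4 + s / Z * (K2 / 4 + K4)"
  show ?thesis
  proof
    have K4: "K4 \<ge> 0" using K3(1) by (simp add: K4_def)
    show "K \<ge> 0" unfolding K_def using K1 K2 K4 s0 Z by simp
    fix z :: real assume z: "z \<ge> 1"
    hence l: "ln z \<ge> 0" by simp
    have "\<bar>(H z)\<^sup>2 - (pi * ln z)\<^sup>2\<bar> = \<bar>H z - pi * ln z\<bar> * \<bar>H z + pi * ln z\<bar>"
      unfolding abs_mult[symmetric] by (simp add: power2_eq_square algebra_simps)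
    also have "\<dots> \<le> K3 * ((2 * pi + K3) * (ln z + 1))"
    proof (intro mult_mono K3(2) z)
      have "\<bar>H z + pi * ln z\<bar> \<le> K3 + 2 * (pi * ln z)" 
        using K3(2)[OF z] mult_nonneg_nonneg[OF pi_ge_zero l] by linarith
      also have "\<dots> \<le> (2 * pi + K3) * (ln z + 1)" using l K3(1) by (simp add: algebra_simps)
      finally show "\<bar>H z + pi * ln z\<bar> \<le> (2 * pi + K3) * (ln z + 1)" .
    qed (use K3 in auto)
    finally have H2: "\<bar>(H z)\<^sup>2 - pi\<^sup>2 * (ln z)\<^sup>2\<bar> \<le> K4 * (ln z + 1)"
      by (simp add: K4_def power_mult_distrib mult.assoc)
    have "\<bar>C z * Z - pi\<^sup>2 * (ln z)\<^sup>2\<bar> \<le> (K2 / 4 + K4) * (ln z + 1)"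
    proof -
      have "C z * (4 * Z) = 4 * (C z * Z)"
        "(K2 / 4 + K4) * (ln z + 1) = K2 * (ln z + 1) / 4 + K4 * (ln z + 1)"
        by (simp_all add: algebra_simps add_divide_distrib)
      thus ?thesis using H2 K2(2)[OF z] by linarith
    qed
    hence "s / Z * \<bar>C z * Z - pi\<^sup>2 * (ln z)\<^sup>2\<bar> \<le> s / Z * ((K2 / 4 + K4) * (ln z + 1))"
      using s0 Z by (intro mult_left_mono) auto
    also have "s / Z * \<bar>C z * Z - pi\<^sup>2 * (ln z)\<^sup>2\<bar> = \<bar>s / Z * (C z * Z - pi\<^sup>2 * (ln z)\<^sup>2)\<bar>"
      using s0 Z by (simp add: abs_mult)
    also have "s / Z * (C z * Z - pi\<^sup>2 * (ln z)\<^sup>2) = C z * s - pi\<^sup>2 * s / Z * (ln z)\<^sup>2"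
      using Z by (simp add: field_simps)
    finally have "\<bar>C z * s - pi\<^sup>2 * s / Z * (ln z)\<^sup>2\<bar> \<le> s / Z * (K2 / 4 + K4) * (ln z + 1)"
      by (simp add: mult.assoc)
    moreover have "\<bar>M z - C z * s\<bar> \<le> K1 / 4 * (ln z + 1)"
    proof -
      have "C z * (4 * s) = 4 * (C z * s)" by simp
      thus ?thesis using K1(2)[OF z] by linarith
    qed
    ultimately have "\<bar>M z - pi\<^sup>2 * s / Z * (ln z)\<^sup>2\<bar> \<le> K1 / 4 * (ln z + 1) + s / Z * (K2 / 4 + K4) * (ln z + 1)"
      by linarith
    also have "\<dots> = K * (ln z + 1)" by (simp add: K_def algebra_simps)
    finally show "\<bar>(\<Sum>(\<alpha>,\<gamma>)\<in>gdisc z \<times> gdisc z. pair_density \<kappa> \<alpha> \<gamma>) -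
      pi\<^sup>2 * sigma_minus_one \<kappa> / zeta_K (2::real) * (ln z)\<^sup>2\<bar> \<le> K * (ln z + 1)"
      by (simp add: M_def s_def Z_def)
  qed
qed

section \<open>Common solutions of the two divisibility conditions\<close>

definition shifted_multiples :: "complex \<Rightarrow> complex \<Rightarrow> complex \<Rightarrow> complex set" where
  "shifted_multiples \<kappa> \<alpha> \<gamma> = {\<nu> \<in> gauss_ints. gdvd \<alpha> \<nu> \<and> gdvd \<gamma> (\<nu> + \<kappa>)}"

lemma shifted_multiples_empty:
  assumes "\<alpha> \<in> gauss_ints" "\<gamma> \<in> gauss_ints" "\<not> gdvd (gauss_gcd \<alpha> \<gamma>) \<kappa>"
  shows "shifted_multiples \<kappa> \<alpha> \<gamma> = {}"
proof -
  have "gdvd (gauss_gcd \<alpha> \<gamma>) \<kappa>" if "gdvd \<alpha> \<nu>" "gdvd \<gamma> (\<nu> + \<kappa>)" for \<nu>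
  proof -
    have "gdvd (gauss_gcd \<alpha> \<gamma>) \<nu>" "gdvd (gauss_gcd \<alpha> \<gamma>) (\<nu> + \<kappa>)"
      using gdvd_trans[OF gauss_gcd(2)[OF assms(1,2)] that(1)]
        gdvd_trans[OF gauss_gcd(3)[OF assms(1,2)] that(2)] .
    from gdvd_diff[OF this(2) this(1)] show ?thesis by simp
  qed
  thus ?thesis using assms(3) unfolding shifted_multiples_def by blast
qed

text \<open>
  The Chinese remainder theorem for moduli that need not be coprime. With \<open>\<alpha> = g a\<close>,
  \<open>\<gamma> = g c\<close>, \<open>\<kappa> = g k\<close> and \<open>u a + v c = 1\<close>, a solution is \<open>r = -k u \<alpha>\<close>, because
  then \<open>r + \<kappa> = k v \<gamma>\<close>, and two solutions differ by a multiple of \<open>lcm(\<alpha>, \<gamma>) = g a c\<close>.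
\<close>

lemma shifted_multiples_residue_class:
  assumes \<alpha>: "\<alpha> \<in> gauss_ints" "\<alpha> \<noteq> 0" and \<gamma>: "\<gamma> \<in> gauss_ints" "\<gamma> \<noteq> 0"
    and \<kappa>: "gdvd (gauss_gcd \<alpha> \<gamma>) \<kappa>"
  obtains r \<theta> where "r \<in> gauss_ints" "\<theta> \<in> gauss_ints" "\<theta> \<noteq> 0"
    "gauss_norm \<theta> = gauss_norm \<alpha> * gauss_norm \<gamma> / gauss_norm (gauss_gcd \<alpha> \<gamma>)"
    "shifted_multiples \<kappa> \<alpha> \<gamma> = {\<nu> \<in> gauss_ints. gdvd \<theta> (\<nu> - r)}"
proof -
  define g where "g = gauss_gcd \<alpha> \<gamma>"
  note gG = gauss_gcd[OF \<alpha>(1) \<gamma>(1), folded g_def]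
  have "g \<in> associates g" using gG by (simp add: associates_def)
  note g = gauss_coprime_div_associate_gcd[OF \<alpha>(1) \<gamma>(1) \<alpha>(2) this[unfolded g_def], folded g_def]
  define a where "a = \<alpha> / g"
  define c where "c = \<gamma> / g"
  have ac: "\<alpha> = g * a" "\<gamma> = g * c" "a \<in> gauss_ints" "c \<in> gauss_ints" "a \<noteq> 0" "c \<noteq> 0"
    using g \<alpha> \<gamma> by (auto simp: a_def c_def)
  obtain u v where uv: "u \<in> gauss_ints" "v \<in> gauss_ints" "u * a + v * c = 1"
    using g(4) by (auto simp: gauss_coprime_def a_def c_def)
  obtain k where k: "k \<in> gauss_ints" "\<kappa> = g * k" using \<kappa> by (auto simp: gdvd_def g_def)
  define r where "r = \<alpha> * (- (k * u))"
  have "r + \<kappa> = g * (k * (u * a + v * c)) + \<alpha> * (- (k * u))" unfolding r_def k(2) uv(3) by simp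
  also have "\<dots> = \<gamma> * (k * v)" unfolding ac(1,2) by (simp add: algebra_simps)
  finally have r': "r + \<kappa> = \<gamma> * (k * v)" .
  have "gdvd \<alpha> \<nu> \<and> gdvd \<gamma> (\<nu> + \<kappa>) \<longleftrightarrow> gdvd (g * (a * c)) (\<nu> - r)" if "\<nu> \<in> gauss_ints" for \<nu>
  proof
    assume *: "gdvd \<alpha> \<nu> \<and> gdvd \<gamma> (\<nu> + \<kappa>)"
    have "gdvd \<alpha> (\<nu> - r)" using * k(1) uv unfolding r_def by (intro gdvd_diff gdvd_triv) simp_all
    then obtain s where s: "s \<in> gauss_ints" "\<nu> - r = \<alpha> * s" by (auto simp: gdvd_def)
    have "gdvd \<gamma> ((\<nu> + \<kappa>) - (r + \<kappa>))" using * k(1) uv by (intro gdvd_diff) (simp_all add: r')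
    then obtain t where t: "t \<in> gauss_ints" "\<nu> - r = \<gamma> * t" by (auto simp: gdvd_def)
    have "\<nu> - r = (u * a + v * c) * (\<nu> - r)" unfolding uv(3) by simp
    also have "\<dots> = u * a * (\<nu> - r) + v * c * (\<nu> - r)" by (rule distrib_right)
    also have "\<dots> = u * a * (\<gamma> * t) + v * c * (\<alpha> * s)"
      by (rule arg_cong2[of _ _ _ _ "\<lambda>p q. u * a * p + v * c * q"]) (rule t(2), rule s(2))
    also have "\<dots> = (g * (a * c)) * (u * t + v * s)" by (simp add: ac algebra_simps)
    finally show "gdvd (g * (a * c)) (\<nu> - r)" using uv s t by simp
  next
    assume "gdvd (g * (a * c)) (\<nu> - r)"
    then obtain s where s: "s \<in> gauss_ints" "\<nu> - r = g * (a * c) * s" by (auto simp: gdvd_def)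
    have "\<nu> = g * (a * c) * s + r" using s(2) by (simp add: algebra_simps)
    also have "\<dots> = \<alpha> * (c * s - k * u)" by (simp add: r_def ac(1) algebra_simps)
    finally have \<nu>: "\<nu> = \<alpha> * (c * s - k * u)" .
    have "\<nu> + \<kappa> = (\<nu> - r) + (r + \<kappa>)" by simp
    also have "\<dots> = g * (a * c) * s + \<gamma> * (k * v)" unfolding s(2) r' ..
    also have "\<dots> = \<gamma> * (a * s + k * v)" by (simp add: ac(2) algebra_simps)
    finally have \<nu>': "\<nu> + \<kappa> = \<gamma> * (a * s + k * v)" .
    have "gdvd \<alpha> \<nu>" unfolding \<nu> using s ac k uv by (intro gdvd_triv) simp
    moreover have "gdvd \<gamma> (\<nu> + \<kappa>)" unfolding \<nu>' using s ac k uv by (intro gdvd_triv) simp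
    ultimately show "gdvd \<alpha> \<nu> \<and> gdvd \<gamma> (\<nu> + \<kappa>)" ..
  qed
  hence eq: "shifted_multiples \<kappa> \<alpha> \<gamma> = {\<nu> \<in> gauss_ints. gdvd (g * (a * c)) (\<nu> - r)}"
    unfolding shifted_multiples_def by blast
  have norm: "gauss_norm (g * (a * c)) = gauss_norm \<alpha> * gauss_norm \<gamma> / gauss_norm g"
    using g(1) unfolding ac(1,2) by (simp add: field_simps)
  show ?thesis
  proof -
    have "r \<in> gauss_ints" using \<alpha> k(1) uv unfolding r_def by simp
    moreover have "g * (a * c) \<in> gauss_ints" "g * (a * c) \<noteq> 0" using gG ac g(1) by auto
    ultimately show ?thesis using that[of r "g * (a * c)"] eq norm by (simp add: g_def)
  qed
qed

text \<open>
  The gcd divides \<open>\<kappa>\<close>, so its norm is at most \<open>N(\<kappa>)\<close>. Hence up to a constant the modulus has norm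
  \<open>N(\<alpha>) N(\<gamma>)\<close>, and the error terms no longer involve the gcd.
\<close>

lemma card_shifted_multiples:
  assumes "\<alpha> \<in> gauss_ints" "\<alpha> \<noteq> 0" "\<gamma> \<in> gauss_ints" "\<gamma> \<noteq> 0" "\<kappa> \<noteq> 0" "x \<ge> 0"
  defines "n \<equiv> real (card {\<nu> \<in> shifted_multiples \<kappa> \<alpha> \<gamma>. gauss_norm \<nu> \<le> x})"
    and "t \<equiv> x * gauss_norm \<kappa> / (gauss_norm \<alpha> * gauss_norm \<gamma>)"
  shows "\<bar>n - pi * x * pair_density \<kappa> \<alpha> \<gamma>\<bar> \<le> 4 * pi * (sqrt t + 1)" "n \<le> 8 * pi * (t + 1)"
proof -
  have t: "t \<ge> 0" using assms by (simp add: t_def)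
  have "\<bar>n - pi * x * pair_density \<kappa> \<alpha> \<gamma>\<bar> \<le> 4 * pi * (sqrt t + 1) \<and> n \<le> 8 * pi * (t + 1)"
  proof (cases "gdvd (gauss_gcd \<alpha> \<gamma>) \<kappa>")
    case False
    hence "n = 0" using assms(1,3) by (simp add: n_def shifted_multiples_empty)
    thus ?thesis using False t by (simp add: pair_density_def)
  next
    case True
    obtain r \<theta> where r: "r \<in> gauss_ints" and \<theta>: "\<theta> \<in> gauss_ints" "\<theta> \<noteq> 0"
      "gauss_norm \<theta> = gauss_norm \<alpha> * gauss_norm \<gamma> / gauss_norm (gauss_gcd \<alpha> \<gamma>)"
      and eq: "shifted_multiples \<kappa> \<alpha> \<gamma> = {\<nu> \<in> gauss_ints. gdvd \<theta> (\<nu> - r)}"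
      using shifted_multiples_residue_class[OF assms(1-4) True] by blast
    have n_eq: "n = real (card {\<nu> \<in> gauss_ints. gdvd \<theta> (\<nu> - r) \<and> gauss_norm \<nu> \<le> x})"
      unfolding n_def eq by (rule arg_cong[of _ _ "\<lambda>S. real (card S)"]) auto
    have "gauss_norm (gauss_gcd \<alpha> \<gamma>) \<le> gauss_norm \<kappa>"
      using True assms(5) by (rule gdvd_imp_gauss_norm_le)
    hence le: "x / gauss_norm \<theta> \<le> t"
      unfolding \<theta>(3) t_def using assms(6) by (simp add: divide_right_mono mult_left_mono)
    have "pi * x / gauss_norm \<theta> = pi * x * pair_density \<kappa> \<alpha> \<gamma>"
      using True unfolding \<theta>(3) by (simp add: pair_density_def)
    hence "\<bar>n - pi * x * pair_density \<kappa> \<alpha> \<gamma>\<bar> \<le> 4 * pi * (sqrt (x / gauss_norm \<theta>) + 1)"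
      using card_residue_class[OF \<theta>(1,2) r assms(6)] by (simp add: n_eq)
    also have "\<dots> \<le> 4 * pi * (sqrt t + 1)"
      using le by (intro mult_left_mono add_right_mono real_sqrt_le_mono) auto
    finally have 1: "\<bar>n - pi * x * pair_density \<kappa> \<alpha> \<gamma>\<bar> \<le> 4 * pi * (sqrt t + 1)" .
    have "n \<le> 8 * pi * (x / gauss_norm \<theta> + 1)"
      unfolding n_eq by (rule card_residue_class_le[OF \<theta>(1,2) r assms(6)])
    also have "\<dots> \<le> 8 * pi * (t + 1)"
      using le by (intro mult_left_mono add_right_mono) auto
    finally show ?thesis using 1 by blast
  qed
  thus "\<bar>n - pi * x * pair_density \<kappa> \<alpha> \<gamma>\<bar> \<le> 4 * pi * (sqrt t + 1)" "n \<le> 8 * pi * (t + 1)"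
    by blast+
qed

section \<open>The hyperbola method\<close>

definition small_divisors :: "real \<Rightarrow> complex \<Rightarrow> real" where
  "small_divisors y \<nu> = real (card {\<alpha> \<in> gdisc y. gdvd \<alpha> \<nu>})"

text \<open>
  Every divisor that the hyperbola method miscounts is among these. The constant 4 leaves room for
  \<open>N(\<nu> + \<kappa>)\<close>, which may exceed \<open>y\<^sup>2\<close> although \<open>N(\<nu>)\<close> does not.
\<close>

definition middle_divisors :: "real \<Rightarrow> complex \<Rightarrow> real" where
  "middle_divisors y \<nu> = real (card {\<alpha> \<in> gdisc (4 * y). gdvd \<alpha> \<nu> \<and> gauss_norm \<nu> \<le> 4 * y * gauss_norm \<alpha>})"

lemma finite_gdisc_filter: "finite {\<alpha> \<in> gdisc z. P \<alpha>}"
  by (rule finite_subset[OF _ finite_gdisc[of z]]) blast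

lemma small_divisors_nonneg [simp]: "small_divisors y \<nu> \<ge> 0"
  and middle_divisors_nonneg [simp]: "middle_divisors y \<nu> \<ge> 0"
  by (simp_all add: small_divisors_def middle_divisors_def)

lemma small_divisors_mono:
  assumes "y \<le> y'"
  shows "small_divisors y \<nu> \<le> small_divisors y' \<nu>"
proof -
  have "{\<alpha> \<in> gdisc y. gdvd \<alpha> \<nu>} \<subseteq> {\<alpha> \<in> gdisc y'. gdvd \<alpha> \<nu>}"
    using gdisc_mono[OF assms] by blast
  from card_mono[OF finite_gdisc_filter this] show ?thesis by (simp add: small_divisors_def)
qed

lemma middle_divisors_le: "middle_divisors y \<nu> \<le> small_divisors (4 * y) \<nu>"
proof -
  have "{\<alpha> \<in> gdisc (4 * y). gdvd \<alpha> \<nu> \<and> gauss_norm \<nu> \<le> 4 * y * gauss_norm \<alpha>}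
          \<subseteq> {\<alpha> \<in> gdisc (4 * y). gdvd \<alpha> \<nu>}"
    by blast
  from card_mono[OF finite_gdisc_filter this] show ?thesis
    by (simp add: small_divisors_def middle_divisors_def)
qed

text \<open>
  The involution \<open>g \<mapsto> \<nu> / g\<close> maps the divisors of norm greater than \<open>y\<close> onto those of norm
  less than \<open>N(\<nu>) / y\<close>. Replacing this threshold by \<open>y\<close> affects only divisors whose norm lies between the two
  thresholds, and these are all counted by \<open>middle_divisors\<close>. Every divisor is counted with its four associates,
  whence the factor 4.
\<close>

lemma divisor_hyperbola:
  assumes \<nu>: "\<nu> \<in> gauss_ints" "\<nu> \<noteq> 0" and y: "y > 0" "gauss_norm \<nu> \<le> 4 * y\<^sup>2"
  shows "\<bar>4 * real (tau \<nu>) - 2 * small_divisors y \<nu>\<bar> \<le> middle_divisors y \<nu>"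
proof -
  define V where "V = {g \<in> gauss_ints. gdvd g \<nu>}"
  define P where "P = {g \<in> V. gauss_norm g \<le> y}"
  define Q where "Q = {g \<in> V. gauss_norm g * y < gauss_norm \<nu>}"
  define R where "R = {\<alpha> \<in> gdisc (4 * y). gdvd \<alpha> \<nu> \<and> gauss_norm \<nu> \<le> 4 * y * gauss_norm \<alpha>}"
  have "finite V" unfolding V_def by (rule finite_gdvd[OF \<nu>(2)])
  moreover have "finite R" unfolding R_def by (rule finite_gdisc_filter)
  ultimately have fin: "finite V" "finite P" "finite Q" "finite R"
    by (simp_all add: P_def Q_def)
  have V0: "g \<noteq> 0" "g \<in> gauss_ints" "gdvd g \<nu>" if "g \<in> V" for g using that \<nu> by (auto simp: V_def)
  have cofactor: "\<nu> / g \<in> V" "gauss_norm (\<nu> / g) = gauss_norm \<nu> / gauss_norm g" if "g \<in> V" for g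
  proof -
    from V0(3)[OF that] obtain c where c: "c \<in> gauss_ints" "\<nu> = g * c" by (auto simp: gdvd_def)
    hence "\<nu> / g = c" using V0[OF that] by simp
    moreover have "gdvd c \<nu>" using c V0[OF that] by (simp add: mult.commute)
    ultimately show "\<nu> / g \<in> V" using c by (simp add: V_def)
  qed (simp add: gauss_norm_divide)
  have "bij_betw (\<lambda>g. \<nu> / g) (V - P) Q"
  proof (rule bij_betw_byWitness[where f' = "\<lambda>g. \<nu> / g"])
    show "(\<lambda>g. \<nu> / g) ` (V - P) \<subseteq> Q"
    proof clarify
      fix g assume g: "g \<in> V" "g \<notin> P"
      have pos: "gauss_norm g > 0" using V0[OF g(1)] by simp
      have "gauss_norm \<nu> * y < gauss_norm \<nu> * gauss_norm g"
        using g \<nu> by (intro mult_strict_left_mono) (auto simp: P_def)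
      hence "gauss_norm \<nu> / gauss_norm g * y < gauss_norm \<nu>" using pos by (simp add: field_simps)
      thus "\<nu> / g \<in> Q" using cofactor[OF g(1)] by (simp only: Q_def mem_Collect_eq)
    qed
    show "(\<lambda>g. \<nu> / g) ` Q \<subseteq> V - P"
    proof clarify
      fix g assume g: "g \<in> Q"
      hence gV: "g \<in> V" by (simp add: Q_def)
      have pos: "gauss_norm g > 0" using V0[OF gV] by simp
      have "y < gauss_norm \<nu> / gauss_norm g" using g pos by (simp add: Q_def field_simps)
      thus "\<nu> / g \<in> V - P" using cofactor[OF gV] by (simp only: P_def mem_Collect_eq Diff_iff) simp
    qed
  qed (use V0 \<nu> in \<open>auto simp: Q_def\<close>)
  hence "card (V - P) = card Q" by (rule bij_betw_same_card)
  moreover have "card V = card P + card (V - P)"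
    using fin by (subst card_Un_disjoint[symmetric]) (auto simp: P_def intro: arg_cong[of _ _ card])
  ultimately have card_V: "card V = card P + card Q" by simp
  have "P \<subseteq> Q \<union> R"
  proof
    fix g assume g: "g \<in> P"
    hence gV: "g \<in> V" "gauss_norm g \<le> y" by (auto simp: P_def)
    have "g \<in> R" if "g \<notin> Q"
    proof -
      have "gauss_norm \<nu> \<le> gauss_norm g * y" using that gV by (simp add: Q_def)
      moreover have "gauss_norm g * y \<ge> 0" using y by simp
      ultimately have "gauss_norm \<nu> \<le> 4 * y * gauss_norm g" by (simp add: algebra_simps)
      thus ?thesis using V0[OF gV(1)] gV y by (auto simp: R_def gdisc_def)
    qed
    thus "g \<in> Q \<union> R" by blast
  qed
  hence "card P \<le> card (Q \<union> R)" using fin by (intro card_mono) auto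
  hence 1: "card P \<le> card Q + card R" using card_Un_le[of Q R] by linarith
  have "Q \<subseteq> P \<union> R"
  proof
    fix g assume g: "g \<in> Q"
    hence gV: "g \<in> V" "gauss_norm g * y < gauss_norm \<nu>" by (auto simp: Q_def)
    have "g \<in> R" if "g \<notin> P"
    proof -
      have gy: "y < gauss_norm g" using that gV by (simp add: P_def)
      have "gauss_norm g * y < 4 * y * y" using gV(2) y(2) by (simp add: power2_eq_square)
      hence "gauss_norm g < 4 * y" using y(1) by (simp add: mult_less_cancel_right_pos)
      moreover have "4 * y * y \<le> 4 * y * gauss_norm g" using gy y(1) by (intro mult_left_mono) auto
      hence "gauss_norm \<nu> \<le> 4 * y * gauss_norm g" using y(2) by (simp add: power2_eq_square)
      ultimately show ?thesis using V0[OF gV(1)] by (simp add: R_def gdisc_def)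
    qed
    thus "g \<in> P \<union> R" by blast
  qed
  hence "card Q \<le> card (P \<union> R)" using fin by (intro card_mono) auto
  hence 2: "card Q \<le> card P + card R" using card_Un_le[of P R] by linarith
  have "4 * real (tau \<nu>) = real (card P) + real (card Q)"
    using tau_eq_card_gdvd[OF \<nu>] card_V by (simp add: V_def)
  moreover have nz: "g \<noteq> 0" if "gdvd g \<nu>" for g using that \<nu>(2) by auto
  have "P = {\<alpha> \<in> gdisc y. gdvd \<alpha> \<nu>}"
    unfolding P_def V_def gdisc_def using nz by blast
  hence "small_divisors y \<nu> = real (card P)" by (simp add: small_divisors_def)
  moreover have "middle_divisors y \<nu> = real (card R)" by (simp add: middle_divisors_def R_def)
  ultimately show ?thesis using 1 2 by (simp add: abs_le_iff)
qed

lemma card_filter_eq_sum_of_bool: "finite A \<Longrightarrow> real (card {a \<in> A. P a}) = (\<Sum>a\<in>A. of_bool (P a))"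
  by (simp add: sum_of_bool_eq Int_def conj_commute)

lemma sum_card_times_card:
  assumes "finite S" "finite A" "finite B"
  shows "(\<Sum>\<nu>\<in>S. real (card {\<alpha> \<in> A. P \<nu> \<alpha>}) * real (card {\<gamma> \<in> B. Q \<nu> \<gamma>})) =
         (\<Sum>(\<alpha>,\<gamma>)\<in>A \<times> B. real (card {\<nu> \<in> S. P \<nu> \<alpha> \<and> Q \<nu> \<gamma>}))"
proof -
  have "(\<Sum>\<nu>\<in>S. real (card {\<alpha> \<in> A. P \<nu> \<alpha>}) * real (card {\<gamma> \<in> B. Q \<nu> \<gamma>})) =
        (\<Sum>\<nu>\<in>S. \<Sum>(\<alpha>,\<gamma>)\<in>A \<times> B. of_bool (P \<nu> \<alpha> \<and> Q \<nu> \<gamma>))"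
    unfolding card_filter_eq_sum_of_bool[OF assms(2)] card_filter_eq_sum_of_bool[OF assms(3)]
      sum_product sum.cartesian_product of_bool_conj ..
  also have "\<dots> = (\<Sum>(\<alpha>,\<gamma>)\<in>A \<times> B. \<Sum>\<nu>\<in>S. of_bool (P \<nu> \<alpha> \<and> Q \<nu> \<gamma>))"
    by (subst sum.swap) (simp add: case_prod_unfold)
  finally show ?thesis using assms by (simp add: card_filter_eq_sum_of_bool)
qed

text \<open>
  For a fixed pair \<open>(\<alpha>, \<gamma>)\<close> the definition of \<open>middle_divisors\<close> confines \<open>\<nu>\<close> to the
  disc \<open>N(\<nu>) \<le> 4 y N(\<alpha>)\<close>, so the number of solutions is \<open>O(y / N(\<gamma>) + 1)\<close>: the
  factor \<open>N(\<alpha>)\<close> cancels. Summing over \<open>O(y)\<close> values of \<open>\<alpha>\<close> leaves one logarithm, from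
  \<open>\<Sum> 1 / N(\<gamma>)\<close>, instead of two. The set \<open>S\<close> is arbitrary, so that the lemma also applies
  after the shift \<open>\<nu> \<mapsto> \<nu> + \<kappa>\<close>.
\<close>

lemma sum_middle_small_divisors:
  assumes "\<kappa> \<in> gauss_ints" "\<kappa> \<noteq> 0"
  obtains K where "K \<ge> 0"
    "\<And>y S. y \<ge> 1 \<Longrightarrow> finite S \<Longrightarrow> S \<subseteq> gauss_ints \<Longrightarrow>
       (\<Sum>\<nu>\<in>S. middle_divisors y \<nu> * small_divisors (4 * y) (\<nu> + \<kappa>)) \<le> K * y\<^sup>2 * (ln y + 1)"
proof -
  obtain K where K: "K > 0" "\<And>z. z \<ge> 1 \<Longrightarrow> recip_norm_sum z \<le> K * (ln z + 1)"
    using recip_norm_sum_le by blast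
  define n where "n = gauss_norm \<kappa>"
  have n: "n \<ge> 0" by (simp add: n_def)
  \<comment> \<open>Here \<open>480 \<pi> = 40 \<pi> * 4 * 3\<close>, where \<open>40 \<pi> y\<close> bounds the number of points of norm at most \<open>4 y\<close> and 3 comes from \<open>log (4 y) + 1 \<le> 3 (log y + 1)\<close>.\<close>
  define K' where "K' = 8 * pi * (480 * pi * n * K + (40 * pi)\<^sup>2)"
  show ?thesis
  proof
    show "K' \<ge> 0" using K n by (simp add: K'_def)
    fix y :: real and S assume y: "y \<ge> 1" and S: "finite S" "S \<subseteq> gauss_ints"
    have ly: "ln y \<ge> 0" using y by simp
    define D where "D = gdisc (4 * y)"
    have D: "finite D" "real (card D) \<le> 40 * pi * y"
      using card_gdisc_le[of "4 * y"] y by (auto simp: D_def)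
    have "ln (4 * y) \<le> 2 + ln y"
      using y ln_le_minus_one[of 2] ln_mult[of 4 y] ln_mult[of 2 2] by simp
    hence "K * (ln (4 * y) + 1) \<le> K * (3 * (ln y + 1))" using K(1) ly by (intro mult_left_mono) auto
    moreover have "recip_norm_sum (4 * y) \<le> K * (ln (4 * y) + 1)" using y by (intro K(2)) simp
    ultimately have H: "recip_norm_sum (4 * y) \<le> 3 * K * (ln y + 1)" by (simp add: mult.assoc mult.left_commute)
    have "(\<Sum>\<nu>\<in>S. middle_divisors y \<nu> * small_divisors (4 * y) (\<nu> + \<kappa>)) =
      (\<Sum>(\<alpha>,\<gamma>)\<in>D \<times> D. real (card {\<nu> \<in> S. (gdvd \<alpha> \<nu> \<and> gauss_norm \<nu> \<le> 4 * y * gauss_norm \<alpha>) \<and> gdvd \<gamma> (\<nu> + \<kappa>)}))"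
      unfolding middle_divisors_def small_divisors_def D_def by (intro sum_card_times_card S) auto
    also have "\<dots> \<le> (\<Sum>(\<alpha>,\<gamma>)\<in>D \<times> D. 8 * pi * (4 * y * n * (1 / gauss_norm \<gamma>) + 1))"
    proof (intro sum_mono, clarify)
      fix \<alpha> \<gamma> assume "\<alpha> \<in> D" "\<gamma> \<in> D"
      note ac = gdiscD[OF this(1)[unfolded D_def]] gdiscD[OF this(2)[unfolded D_def]]
      define x where "x = 4 * y * gauss_norm \<alpha>"
      have "{\<nu> \<in> S. (gdvd \<alpha> \<nu> \<and> gauss_norm \<nu> \<le> x) \<and> gdvd \<gamma> (\<nu> + \<kappa>)}
              \<subseteq> {\<nu> \<in> shifted_multiples \<kappa> \<alpha> \<gamma>. gauss_norm \<nu> \<le> x}"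
        using S by (auto simp: shifted_multiples_def)
      moreover have "finite {\<nu> \<in> shifted_multiples \<kappa> \<alpha> \<gamma>. gauss_norm \<nu> \<le> x}"
        by (rule finite_subset[OF _ finite_gauss_ints_norm_le[of x]]) (auto simp: shifted_multiples_def)
      ultimately have "real (card {\<nu> \<in> S. (gdvd \<alpha> \<nu> \<and> gauss_norm \<nu> \<le> x) \<and> gdvd \<gamma> (\<nu> + \<kappa>)})
          \<le> real (card {\<nu> \<in> shifted_multiples \<kappa> \<alpha> \<gamma>. gauss_norm \<nu> \<le> x})"
        by (simp add: card_mono)
      also have "\<dots> \<le> 8 * pi * (x * gauss_norm \<kappa> / (gauss_norm \<alpha> * gauss_norm \<gamma>) + 1)"
        using ac y assms by (intro card_shifted_multiples) (auto simp: x_def)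
      also have "x * gauss_norm \<kappa> / (gauss_norm \<alpha> * gauss_norm \<gamma>) = 4 * y * n * (1 / gauss_norm \<gamma>)"
        using ac by (simp add: x_def n_def)
      finally show "real (card {\<nu> \<in> S. (gdvd \<alpha> \<nu> \<and> gauss_norm \<nu> \<le> 4 * y * gauss_norm \<alpha>) \<and> gdvd \<gamma> (\<nu> + \<kappa>)})
          \<le> 8 * pi * (4 * y * n * (1 / gauss_norm \<gamma>) + 1)" by (simp add: x_def)
    qed
    also have "\<dots> = real (card D) * (\<Sum>\<gamma>\<in>D. 8 * pi * (4 * y * n * (1 / gauss_norm \<gamma>) + 1))"
      by (simp add: sum.cartesian_product[symmetric])
    also have "(\<Sum>\<gamma>\<in>D. 8 * pi * (4 * y * n * (1 / gauss_norm \<gamma>) + 1)) =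
        8 * pi * (4 * y * n * recip_norm_sum (4 * y) + real (card D))"
    proof -
      have "(\<Sum>\<gamma>\<in>D. 4 * y * n * (1 / gauss_norm \<gamma>)) = 4 * y * n * recip_norm_sum (4 * y)"
        unfolding recip_norm_sum_def D_def by (rule sum_distrib_left[symmetric])
      thus ?thesis unfolding sum_distrib_left[symmetric] sum.distrib by simp
    qed
    also have "real (card D) * (8 * pi * (4 * y * n * recip_norm_sum (4 * y) + real (card D))) \<le>
        40 * pi * y * (8 * pi * (4 * y * n * (3 * K * (ln y + 1)) + 40 * pi * y))"
      using D H y n K ly recip_norm_sum_nonneg[of "4 * y"]
      by (intro mult_mono add_mono mult_left_mono mult_nonneg_nonneg add_nonneg_nonneg) auto
    also have "\<dots> = 8 * pi * (480 * pi * n * K * (ln y + 1) + (40 * pi)\<^sup>2) * y\<^sup>2"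
      by (simp add: power2_eq_square algebra_simps)
    also have "\<dots> \<le> 8 * pi * (480 * pi * n * K * (ln y + 1) + (40 * pi)\<^sup>2 * (ln y + 1)) * y\<^sup>2"
      using ly mult_left_mono[of 1 "ln y + 1" "(40 * pi)\<^sup>2"]
      by (intro mult_right_mono mult_left_mono add_left_mono) auto
    also have "\<dots> = K' * y\<^sup>2 * (ln y + 1)" by (simp add: K'_def algebra_simps)
    finally show "(\<Sum>\<nu>\<in>S. middle_divisors y \<nu> * small_divisors (4 * y) (\<nu> + \<kappa>)) \<le> K' * y\<^sup>2 * (ln y + 1)" .
  qed
qed

text \<open>
  For each pair the number of solutions is its density times the area of the disc, up to
  \<open>O(y / (|\<alpha>| |\<gamma>|) + 1)\<close>. By the arithmetic-geometric mean inequality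
  \<open>2 / (|\<alpha>| |\<gamma>|) \<le> 1 / N(\<alpha>) + 1 / N(\<gamma>)\<close>, so over the \<open>O(y\<^sup>2)\<close> pairs these errors sum to
  \<open>O(y\<^sup>2 log y)\<close>. The excluded values \<open>\<nu> = 0\<close> and \<open>\<nu> = -\<kappa>\<close> change each count by
  at most 2.
\<close>

lemma sum_small_divisors:
  assumes "\<kappa> \<in> gauss_ints" "\<kappa> \<noteq> 0"
  obtains K where "K \<ge> 0"
    "\<And>y. y \<ge> 1 \<Longrightarrow>
       \<bar>(\<Sum>\<nu> | \<nu> \<in> gauss_ints \<and> \<nu> \<noteq> - \<kappa> \<and> 0 < gauss_norm \<nu> \<and> gauss_norm \<nu> \<le> y\<^sup>2.
           small_divisors y \<nu> * small_divisors y (\<nu> + \<kappa>)) -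
        pi * y\<^sup>2 * (\<Sum>(\<alpha>,\<gamma>)\<in>gdisc y \<times> gdisc y. pair_density \<kappa> \<alpha> \<gamma>)\<bar> \<le> K * y\<^sup>2 * (ln y + 1)"
proof -
  obtain K where K: "K > 0" "\<And>z. z \<ge> 1 \<Longrightarrow> recip_norm_sum z \<le> K * (ln z + 1)"
    using recip_norm_sum_le by blast
  define m where "m = cmod \<kappa>"
  have m: "m \<ge> 0" by (simp add: m_def)
  define K' where "K' = 40 * pi\<^sup>2 * m * K + (4 * pi + 2) * (10 * pi)\<^sup>2"
  show ?thesis
  proof
    show "K' \<ge> 0" using K m by (simp add: K'_def)
    fix y :: real assume y: "y \<ge> 1"
    have ly: "ln y \<ge> 0" using y by simp
    define D where "D = gdisc y"
    have D: "finite D" "real (card D) \<le> 10 * pi * y"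
      using card_gdisc_le[of y] y by (auto simp: D_def)
    define S where "S = {\<nu>. \<nu> \<in> gauss_ints \<and> \<nu> \<noteq> - \<kappa> \<and> 0 < gauss_norm \<nu> \<and> gauss_norm \<nu> \<le> y\<^sup>2}"
    have S: "finite S" unfolding S_def
      by (rule finite_subset[OF _ finite_gauss_ints_norm_le[of "y\<^sup>2"]]) auto
    define c where "c = (\<lambda>p. real (card {\<nu> \<in> S. gdvd (fst p) \<nu> \<and> gdvd (snd p) (\<nu> + \<kappa>)}))"
    define w where "w = (\<lambda>p. pi * y\<^sup>2 * pair_density \<kappa> (fst p) (snd p))"
    have "(\<Sum>\<nu>\<in>S. small_divisors y \<nu> * small_divisors y (\<nu> + \<kappa>)) = (\<Sum>p\<in>D \<times> D. c p)"
      unfolding small_divisors_def D_def c_def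
      by (subst sum_card_times_card) (auto simp: S case_prod_unfold)
    moreover have "pi * y\<^sup>2 * (\<Sum>(\<alpha>,\<gamma>)\<in>D \<times> D. pair_density \<kappa> \<alpha> \<gamma>) = (\<Sum>p\<in>D \<times> D. w p)"
      by (simp add: w_def sum_distrib_left case_prod_unfold)
    ultimately have eq: "(\<Sum>\<nu>\<in>S. small_divisors y \<nu> * small_divisors y (\<nu> + \<kappa>)) -
        pi * y\<^sup>2 * (\<Sum>(\<alpha>,\<gamma>)\<in>D \<times> D. pair_density \<kappa> \<alpha> \<gamma>) = (\<Sum>p\<in>D \<times> D. c p - w p)"
      by (simp add: sum_subtractf)
    have "\<bar>\<Sum>p\<in>D \<times> D. c p - w p\<bar> \<le> (\<Sum>p\<in>D \<times> D. \<bar>c p - w p\<bar>)" by (rule sum_abs)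
    also have "\<dots> \<le> (\<Sum>(\<alpha>,\<gamma>)\<in>D \<times> D. 2 * pi * y * m * (1 / gauss_norm \<alpha> + 1 / gauss_norm \<gamma>) + (4 * pi + 2))"
    proof (intro sum_mono, clarify)
      fix \<alpha> \<gamma> assume "\<alpha> \<in> D" "\<gamma> \<in> D"
      note ac = gdiscD[OF this(1)[unfolded D_def]] gdiscD[OF this(2)[unfolded D_def]]
      define T where "T = {\<nu> \<in> shifted_multiples \<kappa> \<alpha> \<gamma>. gauss_norm \<nu> \<le> y\<^sup>2}"
      have T: "finite T" unfolding T_def
        by (rule finite_subset[OF _ finite_gauss_ints_norm_le[of "y\<^sup>2"]]) (auto simp: shifted_multiples_def)
      define T' where "T' = {\<nu> \<in> S. gdvd \<alpha> \<nu> \<and> gdvd \<gamma> (\<nu> + \<kappa>)}"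
      have "T' \<subseteq> T" "T \<subseteq> T' \<union> {0, - \<kappa>}"
        by (auto simp: T'_def T_def S_def shifted_multiples_def)
      hence "card T' \<le> card T" "card T \<le> card (T' \<union> {0, - \<kappa>})"
        using T S by (auto intro!: card_mono simp: T'_def)
      moreover have "card (T' \<union> {0, - \<kappa>}) \<le> card T' + card {0, - \<kappa>}" by (rule card_Un_le)
      moreover have "card {0, - \<kappa>} \<le> 2" by (simp add: card_insert_if)
      ultimately have "\<bar>real (card T') - real (card T)\<bar> \<le> 2" by linarith
      hence 1: "\<bar>c (\<alpha>,\<gamma>) - real (card T)\<bar> \<le> 2" by (simp add: c_def T'_def)
      define t where "t = y\<^sup>2 * gauss_norm \<kappa> / (gauss_norm \<alpha> * gauss_norm \<gamma>)"
      have 2: "\<bar>real (card T) - w (\<alpha>,\<gamma>)\<bar> \<le> 4 * pi * (sqrt t + 1)"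
        unfolding T_def w_def t_def fst_conv snd_conv using ac assms
        by (intro card_shifted_multiples) auto
      have "sqrt t = y * m * sqrt ((1 / gauss_norm \<alpha>) * (1 / gauss_norm \<gamma>))"
        using y by (simp add: t_def m_def real_sqrt_mult real_sqrt_divide)
      also have "\<dots> \<le> y * m * ((1 / gauss_norm \<alpha> + 1 / gauss_norm \<gamma>) / 2)"
        using ac y m by (intro mult_left_mono arith_geo_mean_sqrt) auto
      finally have "4 * pi * (sqrt t + 1) \<le>
          4 * pi * (y * m * ((1 / gauss_norm \<alpha> + 1 / gauss_norm \<gamma>) / 2) + 1)"
        by (intro mult_left_mono) auto
      also have "\<dots> = 2 * pi * y * m * (1 / gauss_norm \<alpha> + 1 / gauss_norm \<gamma>) + 4 * pi"
        by (simp add: algebra_simps)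
      finally show "\<bar>c (\<alpha>,\<gamma>) - w (\<alpha>,\<gamma>)\<bar> \<le>
          2 * pi * y * m * (1 / gauss_norm \<alpha> + 1 / gauss_norm \<gamma>) + (4 * pi + 2)"
        using 1 2 by linarith
    qed
    also have "\<dots> = 2 * pi * y * m * (2 * (real (card D) * recip_norm_sum y)) + (4 * pi + 2) * (real (card D))\<^sup>2"
    proof -
      have "(\<Sum>(\<alpha>,\<gamma>)\<in>D \<times> D. 1 / gauss_norm \<alpha>) = real (card D) * recip_norm_sum y"
        "(\<Sum>(\<alpha>,\<gamma>)\<in>D \<times> D. 1 / gauss_norm \<gamma>) = real (card D) * recip_norm_sum y"
        by (simp_all add: sum.cartesian_product[symmetric] recip_norm_sum_def D_def sum_distrib_left)
      moreover have "(\<Sum>(\<alpha>,\<gamma>)\<in>D \<times> D. 2 * pi * y * m * (1 / gauss_norm \<alpha> + 1 / gauss_norm \<gamma>) + (4 * pi + 2)) =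
          2 * pi * y * m * ((\<Sum>(\<alpha>,\<gamma>)\<in>D \<times> D. 1 / gauss_norm \<alpha>) + (\<Sum>(\<alpha>,\<gamma>)\<in>D \<times> D. 1 / gauss_norm \<gamma>)) +
          (\<Sum>(\<alpha>,\<gamma>)\<in>D \<times> D. 4 * pi + 2)"
        unfolding sum.distrib[symmetric] sum_distrib_left by (intro sum.cong) auto
      moreover have "(\<Sum>(\<alpha>,\<gamma>)\<in>D \<times> D. 4 * pi + 2) = (4 * pi + 2) * (real (card D))\<^sup>2"
        by (simp add: case_prod_unfold card_cartesian_product power2_eq_square)
      ultimately show ?thesis by simp
    qed
    also have "\<dots> \<le> 2 * pi * y * m * (2 * (10 * pi * y * (K * (ln y + 1)))) + (4 * pi + 2) * (10 * pi * y)\<^sup>2"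
      using D K(1) K(2)[OF y] y m ly recip_norm_sum_nonneg[of y]
      by (intro add_mono mult_mono mult_left_mono power_mono mult_nonneg_nonneg add_nonneg_nonneg) auto
    also have "\<dots> = (40 * pi\<^sup>2 * m * K * (ln y + 1) + (4 * pi + 2) * (10 * pi)\<^sup>2) * y\<^sup>2"
      by (simp add: power2_eq_square algebra_simps)
    also have "\<dots> \<le> (40 * pi\<^sup>2 * m * K * (ln y + 1) + (4 * pi + 2) * (10 * pi)\<^sup>2 * (ln y + 1)) * y\<^sup>2"
      using ly mult_left_mono[of 1 "ln y + 1" "(4 * pi + 2) * (10 * pi)\<^sup>2"]
      by (intro mult_right_mono add_left_mono) auto
    also have "\<dots> = K' * y\<^sup>2 * (ln y + 1)" by (simp add: K'_def algebra_simps)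
    finally show "\<bar>(\<Sum>\<nu> | \<nu> \<in> gauss_ints \<and> \<nu> \<noteq> - \<kappa> \<and> 0 < gauss_norm \<nu> \<and> gauss_norm \<nu> \<le> y\<^sup>2.
           small_divisors y \<nu> * small_divisors y (\<nu> + \<kappa>)) -
        pi * y\<^sup>2 * (\<Sum>(\<alpha>,\<gamma>)\<in>gdisc y \<times> gdisc y. pair_density \<kappa> \<alpha> \<gamma>)\<bar> \<le> K' * y\<^sup>2 * (ln y + 1)"
      unfolding S_def[symmetric] D_def[symmetric] eq .
  qed
qed

section \<open>The shifted divisor sum\<close>

text \<open>
  The product \<open>(2 A + E) (2 A' + E')\<close> is expanded. Every term other than \<open>4 A A'\<close> contains an error, and its other factor is at most \<open>2 B\<close> or \<open>2 B'\<close>.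
\<close>

lemma tau_product_approx:
  fixes T T' A A' B B' F F' :: real
  assumes "\<bar>T - 2 * A\<bar> \<le> F" "\<bar>T' - 2 * A'\<bar> \<le> F'" "0 \<le> A" "A \<le> B" "0 \<le> A'" "A' \<le> B'" "F \<le> B" "F' \<le> B'"
  shows "\<bar>T * T' - 4 * (A * A')\<bar> \<le> 3 * (F * B' + F' * B)"
proof -
  define E where "E = T - 2 * A"
  define E' where "E' = T' - 2 * A'"
  have E: "\<bar>E\<bar> \<le> F" "\<bar>E'\<bar> \<le> F'" using assms by (auto simp: E_def E'_def)
  have nn: "F \<ge> 0" "F' \<ge> 0" "B \<ge> 0" "B' \<ge> 0" using assms by linarith+
  have "T * T' - 4 * (A * A') = 2 * (A * E') + 2 * (E * A') + E * E'"
    by (simp add: E_def E'_def algebra_simps)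
  hence "\<bar>T * T' - 4 * (A * A')\<bar> \<le> 2 * \<bar>A * E'\<bar> + 2 * \<bar>E * A'\<bar> + \<bar>E * E'\<bar>" by linarith
  moreover have "\<bar>A * E'\<bar> \<le> B * F'" "\<bar>E * A'\<bar> \<le> F * B'" "\<bar>E * E'\<bar> \<le> F * B'"
    unfolding abs_mult using assms E nn by (auto intro!: mult_mono)
  moreover have "F * B' \<ge> 0" "B * F' \<ge> 0" using nn by auto
  ultimately have "\<bar>T * T' - 4 * (A * A')\<bar> \<le> 3 * (F * B' + B * F')" by argo
  thus ?thesis by (simp add: mult.commute)
qed

text \<open>
  The theorem in the variable \<open>y = \<surd>x\<close>. The condition \<open>|\<kappa>| \<le> y\<close> ensures
  \<open>N(\<nu> + \<kappa>) \<le> 4 y\<^sup>2\<close>, so that \<open>divisor_hyperbola\<close> applies to both factors. Of the two error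
  sums, one is brought into the form of \<open>sum_middle_small_divisors\<close> by shifting \<open>\<nu>\<close>, with \<open>-\<kappa>\<close> in place of
  \<open>\<kappa>\<close>.
\<close>

lemma sum_tau_tau_shift:
  assumes "\<kappa> \<in> gauss_ints" "\<kappa> \<noteq> 0"
  obtains K where
    "\<And>y. y \<ge> 1 \<Longrightarrow> cmod \<kappa> \<le> y \<Longrightarrow>
       \<bar>(\<Sum>\<nu> | \<nu> \<in> gauss_ints \<and> \<nu> \<noteq> - \<kappa> \<and> 0 < gauss_norm \<nu> \<and> gauss_norm \<nu> \<le> y\<^sup>2.
           real (tau \<nu>) * real (tau (\<nu> + \<kappa>))) -
        pi ^ 3 * sigma_minus_one \<kappa> / (4 * zeta_K (2::real)) * y\<^sup>2 * (ln y)\<^sup>2\<bar> \<le> K * y\<^sup>2 * (ln y + 1)"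
proof -
  obtain K1 where K1: "K1 \<ge> 0" "\<And>y S. y \<ge> 1 \<Longrightarrow> finite S \<Longrightarrow> S \<subseteq> gauss_ints \<Longrightarrow>
       (\<Sum>\<nu>\<in>S. middle_divisors y \<nu> * small_divisors (4 * y) (\<nu> + \<kappa>)) \<le> K1 * y\<^sup>2 * (ln y + 1)"
    using that by (rule sum_middle_small_divisors[OF assms])
  have neg: "- \<kappa> \<in> gauss_ints" "- \<kappa> \<noteq> 0" using assms by auto
  obtain K2 where K2: "K2 \<ge> 0" "\<And>y S. y \<ge> 1 \<Longrightarrow> finite S \<Longrightarrow> S \<subseteq> gauss_ints \<Longrightarrow>
       (\<Sum>\<nu>\<in>S. middle_divisors y \<nu> * small_divisors (4 * y) (\<nu> + (- \<kappa>))) \<le> K2 * y\<^sup>2 * (ln y + 1)"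
    using that by (rule sum_middle_small_divisors[OF neg])
  obtain K3 where K3: "K3 \<ge> 0" "\<And>y. y \<ge> 1 \<Longrightarrow>
       \<bar>(\<Sum>\<nu> | \<nu> \<in> gauss_ints \<and> \<nu> \<noteq> - \<kappa> \<and> 0 < gauss_norm \<nu> \<and> gauss_norm \<nu> \<le> y\<^sup>2.
           small_divisors y \<nu> * small_divisors y (\<nu> + \<kappa>)) -
        pi * y\<^sup>2 * (\<Sum>(\<alpha>,\<gamma>)\<in>gdisc y \<times> gdisc y. pair_density \<kappa> \<alpha> \<gamma>)\<bar> \<le> K3 * y\<^sup>2 * (ln y + 1)"
    using that by (rule sum_small_divisors[OF assms])
  obtain K4 where K4: "K4 \<ge> 0" "\<And>z. z \<ge> 1 \<Longrightarrow>
    \<bar>(\<Sum>(\<alpha>,\<gamma>)\<in>gdisc z \<times> gdisc z. pair_density \<kappa> \<alpha> \<gamma>) -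
      pi\<^sup>2 * sigma_minus_one \<kappa> / zeta_K (2::real) * (ln z)\<^sup>2\<bar> \<le> K4 * (ln z + 1)"
    using that by (rule sum_pair_density_asymp[OF assms])
  define K where "K = (3 * (K1 + K2) + 4 * (K3 + pi * K4)) / 16"
  show ?thesis
  proof
    fix y :: real assume y: "y \<ge> 1" "cmod \<kappa> \<le> y"
    have ly: "ln y \<ge> 0" using y by simp
    define L where "L = y\<^sup>2 * (ln y + 1)"
    define S where "S = {\<nu>. \<nu> \<in> gauss_ints \<and> \<nu> \<noteq> - \<kappa> \<and> 0 < gauss_norm \<nu> \<and> gauss_norm \<nu> \<le> y\<^sup>2}"
    have S: "finite S" "S \<subseteq> gauss_ints" unfolding S_def
      by (rule finite_subset[OF _ finite_gauss_ints_norm_le[of "y\<^sup>2"]]) auto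
    define T where "T = (\<lambda>\<nu>. 4 * real (tau \<nu>))"
    define A where "A = small_divisors y"
    define B where "B = small_divisors (4 * y)"
    define F where "F = middle_divisors y"
    define m where "m = pi\<^sup>2 * sigma_minus_one \<kappa> / zeta_K (2::real) * (ln y)\<^sup>2"
    define M where "M = (\<Sum>(\<alpha>,\<gamma>)\<in>gdisc y \<times> gdisc y. pair_density \<kappa> \<alpha> \<gamma>)"
    have A0: "0 \<le> A \<mu>" for \<mu> by (simp add: A_def)
    have AB: "A \<mu> \<le> B \<mu>" for \<mu> unfolding A_def B_def using y by (intro small_divisors_mono) simp
    have FB: "F \<mu> \<le> B \<mu>" for \<mu> unfolding F_def B_def by (rule middle_divisors_le)
    have approx: "\<bar>T \<nu> * T (\<nu> + \<kappa>) - 4 * (A \<nu> * A (\<nu> + \<kappa>))\<bar> \<le>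
        3 * (F \<nu> * B (\<nu> + \<kappa>) + F (\<nu> + \<kappa>) * B \<nu>)" if "\<nu> \<in> S" for \<nu>
    proof (rule tau_product_approx)
      have nu: "\<nu> \<in> gauss_ints" "\<nu> \<noteq> 0" "\<nu> + \<kappa> \<noteq> 0" "gauss_norm \<nu> \<le> y\<^sup>2"
        using that by (auto simp: S_def eq_neg_iff_add_eq_0)
      have "cmod \<nu> \<le> y" using nu(4) y by (simp add: gauss_norm_le_iff)
      hence "cmod (\<nu> + \<kappa>) \<le> 2 * y" using norm_triangle_ineq[of \<nu> \<kappa>] y(2) by linarith
      hence "(cmod (\<nu> + \<kappa>))\<^sup>2 \<le> (2 * y)\<^sup>2" by (intro power_mono) auto
      hence le: "gauss_norm (\<nu> + \<kappa>) \<le> 4 * y\<^sup>2" by (simp add: gauss_norm_def power_mult_distrib)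
      have le': "gauss_norm \<nu> \<le> 4 * y\<^sup>2" using nu(4) zero_le_power2[of y] by linarith
      show "\<bar>T \<nu> - 2 * A \<nu>\<bar> \<le> F \<nu>"
        unfolding T_def A_def F_def using nu y le' by (intro divisor_hyperbola) auto
      show "\<bar>T (\<nu> + \<kappa>) - 2 * A (\<nu> + \<kappa>)\<bar> \<le> F (\<nu> + \<kappa>)"
        unfolding T_def A_def F_def using nu y le assms by (intro divisor_hyperbola) auto
    qed (rule A0 AB FB)+
    have "\<bar>(\<Sum>\<nu>\<in>S. T \<nu> * T (\<nu> + \<kappa>)) - 4 * (\<Sum>\<nu>\<in>S. A \<nu> * A (\<nu> + \<kappa>))\<bar> =
          \<bar>\<Sum>\<nu>\<in>S. T \<nu> * T (\<nu> + \<kappa>) - 4 * (A \<nu> * A (\<nu> + \<kappa>))\<bar>"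
      by (simp add: sum_subtractf sum_distrib_left)
    also have "\<dots> \<le> (\<Sum>\<nu>\<in>S. \<bar>T \<nu> * T (\<nu> + \<kappa>) - 4 * (A \<nu> * A (\<nu> + \<kappa>))\<bar>)"
      by (rule sum_abs)
    also have "\<dots> \<le> (\<Sum>\<nu>\<in>S. 3 * (F \<nu> * B (\<nu> + \<kappa>) + F (\<nu> + \<kappa>) * B \<nu>))"
      by (intro sum_mono approx)
    also have "\<dots> = 3 * ((\<Sum>\<nu>\<in>S. F \<nu> * B (\<nu> + \<kappa>)) + (\<Sum>\<nu>\<in>S. F (\<nu> + \<kappa>) * B \<nu>))"
      by (simp add: sum_distrib_left[symmetric] sum.distrib)
    also have "(\<Sum>\<nu>\<in>S. F (\<nu> + \<kappa>) * B \<nu>) = (\<Sum>\<mu>\<in>(\<lambda>\<nu>. \<nu> + \<kappa>) ` S. F \<mu> * B (\<mu> + (- \<kappa>)))"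
      by (subst sum.reindex) (auto intro: inj_onI)
    also have "3 * ((\<Sum>\<nu>\<in>S. F \<nu> * B (\<nu> + \<kappa>)) + (\<Sum>\<mu>\<in>(\<lambda>\<nu>. \<nu> + \<kappa>) ` S. F \<mu> * B (\<mu> + (- \<kappa>)))) \<le>
        3 * (K1 * y\<^sup>2 * (ln y + 1) + K2 * y\<^sup>2 * (ln y + 1))"
      unfolding F_def B_def using S y assms by (intro mult_left_mono add_mono K1(2) K2(2)) auto
    also have "\<dots> = 3 * (K1 + K2) * L" by (simp add: L_def algebra_simps)
    finally have 1: "\<bar>(\<Sum>\<nu>\<in>S. T \<nu> * T (\<nu> + \<kappa>)) - 4 * (\<Sum>\<nu>\<in>S. A \<nu> * A (\<nu> + \<kappa>))\<bar> \<le> 3 * (K1 + K2) * L" .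
    have 2: "\<bar>(\<Sum>\<nu>\<in>S. A \<nu> * A (\<nu> + \<kappa>)) - pi * y\<^sup>2 * M\<bar> \<le> K3 * L"
      using K3(2)[OF y(1)] by (simp add: A_def S_def M_def L_def mult.assoc)
    have "pi * y\<^sup>2 * \<bar>M - m\<bar> \<le> pi * y\<^sup>2 * (K4 * (ln y + 1))"
      unfolding M_def m_def by (intro mult_left_mono K4(2) y) auto
    hence 3: "\<bar>pi * y\<^sup>2 * M - pi * y\<^sup>2 * m\<bar> \<le> pi * K4 * L"
    proof -
      have "pi * y\<^sup>2 * M - pi * y\<^sup>2 * m = pi * y\<^sup>2 * (M - m)" by (simp only: right_diff_distrib)
      also have "\<bar>\<dots>\<bar> = pi * y\<^sup>2 * \<bar>M - m\<bar>" by (simp add: abs_mult)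
      finally show ?thesis using \<open>pi * y\<^sup>2 * \<bar>M - m\<bar> \<le> pi * y\<^sup>2 * (K4 * (ln y + 1))\<close>
        by (simp only: L_def mult.assoc mult.left_commute)
    qed
    have "\<bar>(\<Sum>\<nu>\<in>S. T \<nu> * T (\<nu> + \<kappa>)) - 4 * (pi * y\<^sup>2 * m)\<bar> \<le> 3 * (K1 + K2) * L + 4 * (K3 * L + pi * K4 * L)"
    proof -
      have "\<bar>x - 4 * v\<bar> \<le> p + 4 * (q + r)"
        if "\<bar>x - 4 * a\<bar> \<le> p" "\<bar>a - w\<bar> \<le> q" "\<bar>w - v\<bar> \<le> r" for x a w v p q r :: real
        using that abs_triangle_ineq[of "x - 4 * a" "4 * (a - v)"]
          abs_triangle_ineq[of "a - w" "w - v"] abs_mult[of 4 "a - v"] by simp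
      from this[OF 1 2 3] show ?thesis .
    qed
    moreover have "(\<Sum>\<nu>\<in>S. T \<nu> * T (\<nu> + \<kappa>)) = 16 * (\<Sum>\<nu>\<in>S. real (tau \<nu>) * real (tau (\<nu> + \<kappa>)))"
      by (simp add: T_def sum_distrib_left mult_ac)
    moreover have "4 * (pi * y\<^sup>2 * m) = 16 * (pi ^ 3 * sigma_minus_one \<kappa> / (4 * zeta_K (2::real)) * y\<^sup>2 * (ln y)\<^sup>2)"
      by (simp add: m_def power3_eq_cube power2_eq_square)
    moreover have "3 * (K1 + K2) * L + 4 * (K3 * L + pi * K4 * L) = 16 * (K * L)"
      by (simp add: K_def algebra_simps)
    ultimately have "\<bar>16 * (\<Sum>\<nu>\<in>S. real (tau \<nu>) * real (tau (\<nu> + \<kappa>))) -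
        16 * (pi ^ 3 * sigma_minus_one \<kappa> / (4 * zeta_K (2::real)) * y\<^sup>2 * (ln y)\<^sup>2)\<bar> \<le> 16 * (K * L)"
      by simp
    hence "\<bar>(\<Sum>\<nu>\<in>S. real (tau \<nu>) * real (tau (\<nu> + \<kappa>))) -
        pi ^ 3 * sigma_minus_one \<kappa> / (4 * zeta_K (2::real)) * y\<^sup>2 * (ln y)\<^sup>2\<bar> \<le> K * L"
      by linarith
    thus "\<bar>(\<Sum>\<nu> | \<nu> \<in> gauss_ints \<and> \<nu> \<noteq> - \<kappa> \<and> 0 < gauss_norm \<nu> \<and> gauss_norm \<nu> \<le> y\<^sup>2.
           real (tau \<nu>) * real (tau (\<nu> + \<kappa>))) -
        pi ^ 3 * sigma_minus_one \<kappa> / (4 * zeta_K (2::real)) * y\<^sup>2 * (ln y)\<^sup>2\<bar> \<le> K * y\<^sup>2 * (ln y + 1)"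
      by (simp add: S_def L_def mult.assoc)
  qed
qed

theorem theorem6p8:
  fixes \<kappa> :: complex
  assumes "\<kappa> \<in> gauss_ints" and "\<kappa> \<noteq> 0"
  shows "(\<lambda>x::real.
            (\<Sum>\<nu> | \<nu> \<in> gauss_ints \<and> \<nu> \<noteq> - \<kappa> \<and> 0 < gauss_norm \<nu> \<and> gauss_norm \<nu> \<le> x.
               real (tau \<nu>) * real (tau (\<nu> + \<kappa>)))
            - pi ^ 3 / (16 * zeta_K (2::real)) * sigma_minus_one \<kappa> * x * (ln x)\<^sup>2)
         \<in> O[at_top](\<lambda>x. x * ln x)"
proof -
  obtain K where K: "\<And>y. y \<ge> 1 \<Longrightarrow> cmod \<kappa> \<le> y \<Longrightarrow>
       \<bar>(\<Sum>\<nu> | \<nu> \<in> gauss_ints \<and> \<nu> \<noteq> - \<kappa> \<and> 0 < gauss_norm \<nu> \<and> gauss_norm \<nu> \<le> y\<^sup>2.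
           real (tau \<nu>) * real (tau (\<nu> + \<kappa>))) -
        pi ^ 3 * sigma_minus_one \<kappa> / (4 * zeta_K (2::real)) * y\<^sup>2 * (ln y)\<^sup>2\<bar> \<le> K * y\<^sup>2 * (ln y + 1)"
    using that by (rule sum_tau_tau_shift[OF assms])
  show ?thesis
  proof (rule bigoI[where c = "\<bar>K\<bar> * 2"])
    \<comment> \<open>Beyond \<open>x = e\<close> the error \<open>log x / 2 + 1\<close> is at most \<open>2 log x\<close>.\<close>
    show "\<forall>\<^sub>F x in at_top. norm ((\<Sum>\<nu> | \<nu> \<in> gauss_ints \<and> \<nu> \<noteq> - \<kappa> \<and> 0 < gauss_norm \<nu> \<and> gauss_norm \<nu> \<le> x.
               real (tau \<nu>) * real (tau (\<nu> + \<kappa>)))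
            - pi ^ 3 / (16 * zeta_K (2::real)) * sigma_minus_one \<kappa> * x * (ln x)\<^sup>2)
          \<le> \<bar>K\<bar> * 2 * norm (x * ln x)"
      using eventually_ge_at_top[of "max (exp 1) ((cmod \<kappa>)\<^sup>2)"]
    proof eventually_elim
      case (elim x)
      define y where "y = sqrt x"
      have x: "x \<ge> exp 1" "(cmod \<kappa>)\<^sup>2 \<le> x" using elim by auto
      have "exp 1 \<ge> (1::real)" by simp
      hence x1: "x \<ge> 1" using x by linarith
      have lx: "ln x \<ge> 1" using x x1 by (subst ln_ge_iff) auto
      have y: "y \<ge> 1" "cmod \<kappa> \<le> y" "y\<^sup>2 = x" "ln y = ln x / 2"
        using x x1 by (auto simp: y_def ln_sqrt real_le_rsqrt)
      have "pi ^ 3 / (16 * zeta_K (2::real)) * sigma_minus_one \<kappa> * x * (ln x)\<^sup>2 =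
            pi ^ 3 * sigma_minus_one \<kappa> / (4 * zeta_K (2::real)) * x * (ln x / 2)\<^sup>2"
        by (simp add: power2_eq_square)
      hence "\<bar>(\<Sum>\<nu> | \<nu> \<in> gauss_ints \<and> \<nu> \<noteq> - \<kappa> \<and> 0 < gauss_norm \<nu> \<and> gauss_norm \<nu> \<le> x.
               real (tau \<nu>) * real (tau (\<nu> + \<kappa>)))
            - pi ^ 3 / (16 * zeta_K (2::real)) * sigma_minus_one \<kappa> * x * (ln x)\<^sup>2\<bar>
          \<le> K * x * (ln x / 2 + 1)"
        using K[OF y(1,2)] unfolding y(3,4) by simp
      also have "\<dots> \<le> \<bar>K\<bar> * x * (2 * ln x)"
        using x1 lx by (intro mult_mono) auto
      finally show ?case using x1 lx by (simp add: mult_ac)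
    qed
  qed
qed

end
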